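(* Let $D\subseteq\mathbb{R}$ be an open interval, let $f:D\to\mathbb{R}$ be a sufficiently differentiable function, and let $\alpha\in D$ be a simple root of $f(x)=0$. Let $\kappa\neq0$, $g_1,g_2,h_1,h_2,h_3,h_4,h_5$ be real numbers, and let $G_0,G_1$ (one variable), $G_2$ (two variables), $S_0$ (three variables), $S_1,S_2,S_3,S_4$ (four variables) and $S_5$ (five variables) be real weight functions. Consider the iterative scheme $$w_n=x_n-\kappa f(x_n),\qquad y_n=x_n-\frac{f(x_n)}{f[x_n,w_n]},$$ $$z_n=y_n-\left[\frac{1-g_1-g_2}{f[y_n,w_n]}G_0(t_1)+\frac{g_1}{f[y_n,x_n]}G_1(t_2)+\frac{g_2}{f[x_n,w_n]}G_2(t_1,t_2)\right]f(y_n),$$ $$\begin{aligned}x_{n+1}=z_n-\Big[&\frac{1-h_1-h_2-h_3-h_4-h_5}{f[y_n,z_n]}S_0(t_3,t_4,t_5)+\frac{h_1}{f[z_n,w_n]}S_1(t_1,t_3,t_4,t_5)+\frac{h_2}{f[z_n,x_n]}S_2(t_2,t_3,t_4,t_5)\\&+\frac{h_3}{f[x_n,y_n]}S_3(t_2,t_3,t_4,t_5)+\frac{h_4}{f[y_n,w_n]}S_4(t_1,t_3,t_4,t_5)+\frac{h_5}{f[x_n,w_n]}S_5(t_1,t_2,t_3,t_4,t_5)\Big]f(z_n),\end{aligned}$$ where $t_1=\frac{f(y_n)}{f(x_n)}$, $t_2=\frac{f(y_n)}{f(w_n)}$, $t_3=\frac{f(z_n)}{f(x_n)}$, $t_4=\frac{f(z_n)}{f(w_n)}$,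 $t_5=\frac{f(z_n)}{f(y_n)}$. Suppose that $$G_0(0)=G_1(0)=G_2(0,0)=1,\quad \frac{dG_0}{dt_1}(0)=\frac{dG_1}{dt_2}(0)=\frac{\partial G_2}{\partial t_1}(0,0)=\frac{\partial G_2}{\partial t_2}(0,0)=1,$$ that $S_0(0,0,0)=1$, $S_i(0,0,0,0)=1$ for $i=1,2,3,4$, $S_5(0,0,0,0,0)=1$, $$\frac{\partial S_1}{\partial t_1}(0,0,0,0)=1,\quad \frac{\partial S_2}{\partial t_2}(0,0,0,0)=1,\quad \frac{\partial S_3}{\partial t_2}(0,0,0,0)=1,\quad \frac{\partial S_4}{\partial t_1}(0,0,0,0)=1,$$ $$\frac{\partial S_5}{\partial t_1}(0,0,0,0,0)=1,\quad \frac{\partial S_5}{\partial t_2}(0,0,0,0,0)=1,$$ and that all higher order derivatives of all these functions are bounded. If $x_0$ is chosen sufficiently close to $\alpha$, then the scheme converges to $\alpha$ with convergence order at least six.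
   Context: Divided difference: $f[a,b]=\frac{f(a)-f(b)}{a-b}$ for $a\neq b$. Write $e_n=x_n-\alpha$. Convergence order at least $p$ means that the error satisfies $e_{n+1}=K e_n^{p}+O(e_n^{p+1})$ as $x_n\to\alpha$, where $K$ is a constant depending on $f$, the parameters and the weight functions (possibly zero). The iteration formulas are understood at steps where all denominators are nonzero. The weight functions are smooth near the origin, and "higher order derivatives" are those beyond the prescribed ones. Partial derivatives are taken with respect to the named variables $t_i$ in the arguments displayed in the scheme. *)

theory Defs
  imports "HOL-Analysis.Analysis" "HOL-Library.Landau_Symbols"
begin

definition divdiff :: "(real \<Rightarrow> real) \<Rightarrow> real \<Rightarrow> real \<Rightarrow> real" where
  "divdiff f a b = (f a - f b) / (a - b)"

(* The mixed partial derivative of f along a list of directions; the head of the list is the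
   direction of the last differentiation. *)
definition iter_partial ::
  "'a::euclidean_space list \<Rightarrow> ('a \<Rightarrow> real) \<Rightarrow> 'a \<Rightarrow> real" where
  "iter_partial vs f = foldr (\<lambda>v g. \<lambda>x. frechet_derivative g (at x) v) vs f"

(* frechet_derivative is meaningless at points of non-differentiability, hence the explicit
   differentiability of all lower-order partial derivatives. *)
definition Ck_on :: "nat \<Rightarrow> ('a::euclidean_space \<Rightarrow> real) \<Rightarrow> 'a set \<Rightarrow> bool" where
  "Ck_on k f U \<longleftrightarrow>
     (\<forall>vs. set vs \<subseteq> Basis \<longrightarrow>
        (length vs < k \<longrightarrow> (\<forall>x\<in>U. iter_partial vs f differentiable (at x))) \<and>
        (length vs \<le> k \<longrightarrow> continuous_on U (iter_partial vs f)))"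

definition smooth_near :: "'a::euclidean_space \<Rightarrow> ('a \<Rightarrow> real) \<Rightarrow> bool" where
  "smooth_near a f \<longleftrightarrow> (\<exists>U. open U \<and> a \<in> U \<and> (\<forall>k. Ck_on k f U))"

definition derivs_bounded_near :: "'a::euclidean_space \<Rightarrow> ('a \<Rightarrow> real) \<Rightarrow> bool" where
  "derivs_bounded_near a f \<longleftrightarrow>
     (\<forall>vs. vs \<noteq> [] \<and> set vs \<subseteq> Basis \<longrightarrow> Bfun (iter_partial vs f) (nhds a))"

(* A weight function. Bounds are imposed on all derivatives of order at least 1; for the
   first-order ones with a prescribed value at the origin this adds nothing to smoothness. *)
definition weight_fun :: "('a::euclidean_space \<Rightarrow> real) \<Rightarrow> bool" where
  "weight_fun f \<longleftrightarrow> smooth_near 0 f \<and> derivs_bounded_near 0 f"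

(* x_{n+1} = \<Phi> x_n is a one-point iteration whose formulas make sense exactly on A.
   The constant K of the error equation depends only on the iteration, not on the starting
   point, so the error equation is an expansion of the iteration function at \<alpha>. *)
definition convergence_order_ge ::
  "nat \<Rightarrow> (real \<Rightarrow> real) \<Rightarrow> real set \<Rightarrow> real \<Rightarrow> bool" where
  "convergence_order_ge p \<Phi> A \<alpha> \<longleftrightarrow>
     (\<exists>K. (\<lambda>x. (\<Phi> x - \<alpha>) - K * (x - \<alpha>) ^ p) \<in> O[at \<alpha> within A](\<lambda>x. (x - \<alpha>) ^ (p + 1)))"

definition locally_convergent :: "(real \<Rightarrow> real) \<Rightarrow> real set \<Rightarrow> real \<Rightarrow> bool" where
  "locally_convergent \<Phi> A \<alpha> \<longleftrightarrow>
     (\<exists>\<delta>>0. \<forall>x :: nat \<Rightarrow> real.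
        \<bar>x 0 - \<alpha>\<bar> < \<delta> \<and> (\<forall>n. x n \<in> A \<and> x (Suc n) = \<Phi> (x n)) \<longrightarrow> x \<longlonglongrightarrow> \<alpha>)"

end

(* Write e = x - \<alpha> and f[a,b,c] for second divided differences. Then
   y - \<alpha> = e * (w - \<alpha>) * f[x,w,\<alpha>] / f[x,w] exactly, and
   z - \<alpha> = (y - \<alpha>) * N, \<Phi> x - \<alpha> = (z - \<alpha>) * M, where N is 1 - f[y,\<alpha>] times the first bracket
   and M is 1 - f[z,\<alpha>] times the second one. With c = f''(\<alpha>) / (2 f'(\<alpha>)) and
   om = 1 - \<kappa> f'(\<alpha>), each quotient such as f[y,\<alpha>] / f[y,w] is 1 - c * om * e + O(e^2), while
   t1 = c * om * e + O(e^2) and t2 = c * e + O(e^2); the conditions on the first derivatives of the weights make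
   the linear terms cancel in every summand. So N and M are multiples of e^2 up to O(e^3), and
   \<Phi> x - \<alpha> is K * e^6 up to O(e^7). Only expansions up to an O(e^3) error are needed, which is
   why f of class C^4 suffices. *)

theory Submission
  imports Defs
begin

section \<open>Second-order expansions at a point\<close>

text \<open>The limit is taken along \<open>at \<alpha> within A\<close> because the iteration
  formulas make sense only on \<open>A\<close>; nothing is imposed at \<alpha> itself.\<close>

definition expands3 :: "real \<Rightarrow> real set \<Rightarrow> real \<Rightarrow> real \<Rightarrow> real \<Rightarrow> (real \<Rightarrow> real) \<Rightarrow> bool" where
  "expands3 \<alpha> A a b c u \<longleftrightarrow>
     (\<lambda>x. u x - (a + b * (x - \<alpha>) + c * (x - \<alpha>)^2)) \<in> O[at \<alpha> within A](\<lambda>x. (x - \<alpha>)^3)"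

text \<open>The quadratic coefficient is hidden: only constant and linear coefficients have to be
  computed, and for factors of order two the mere existence of a leading coefficient
  suffices.\<close>

definition expands :: "real \<Rightarrow> real set \<Rightarrow> real \<Rightarrow> real \<Rightarrow> (real \<Rightarrow> real) \<Rightarrow> bool" where
  "expands \<alpha> A a b u \<longleftrightarrow> (\<exists>c. expands3 \<alpha> A a b c u)"

lemma tendsto_err: "((\<lambda>x::real. x - \<alpha>) \<longlongrightarrow> 0) (at \<alpha> within A)"
  by (auto intro!: tendsto_eq_intros)

lemma bigo_one_of_tendsto:
  fixes u :: "real \<Rightarrow> real"
  assumes "(u \<longlongrightarrow> a) F"
  shows "u \<in> O[F](\<lambda>_. 1)"
proof -
  have "\<forall>\<^sub>F x in F. norm (u x - a) < 1"
    using assms by (simp add: tendsto_iff dist_norm)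
  then have "\<forall>\<^sub>F x in F. norm (u x) \<le> (\<bar>a\<bar> + 1) * norm (1::real)"
    by eventually_elim auto
  then show ?thesis by (rule bigoI)
qed

lemma err_power_mono:
  fixes \<alpha> :: real
  assumes "m \<le> n"
  shows "(\<lambda>x. (x - \<alpha>)^n) \<in> O[at \<alpha> within A](\<lambda>x. (x - \<alpha>)^m)"
proof -
  have "\<forall>\<^sub>F x in at \<alpha> within A. norm (x - \<alpha>) < 1"
    using tendsto_err[of \<alpha> A] by (auto simp: tendsto_iff dist_norm)
  then have "\<forall>\<^sub>F x in at \<alpha> within A. norm ((x - \<alpha>)^n) \<le> 1 * norm ((x - \<alpha>)^m)"
    by eventually_elim (use assms in \<open>simp add: power_abs power_decreasing\<close>)
  then show ?thesis by (rule bigoI)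
qed

lemma expands3_tendsto:
  assumes "expands3 \<alpha> A a b c u"
  shows "(u \<longlongrightarrow> a) (at \<alpha> within A)"
proof -
  obtain C where "\<forall>\<^sub>F x in at \<alpha> within A.
      norm (u x - (a + b * (x - \<alpha>) + c * (x - \<alpha>)^2)) \<le> C * norm ((x - \<alpha>)^3)"
    using assms by (auto simp: expands3_def elim: landau_o.bigE)
  moreover have "((\<lambda>x. C * norm ((x - \<alpha>)^3)) \<longlongrightarrow> 0) (at \<alpha> within A)"
    by (auto intro!: tendsto_eq_intros)
  ultimately have "((\<lambda>x. u x - (a + b * (x - \<alpha>) + c * (x - \<alpha>)^2)) \<longlongrightarrow> 0) (at \<alpha> within A)"
    by (rule Lim_null_comparison)
  moreover have "((\<lambda>x. a + b * (x - \<alpha>) + c * (x - \<alpha>)^2) \<longlongrightarrow> a) (at \<alpha> within A)"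
    by (auto intro!: tendsto_eq_intros)
  ultimately have "((\<lambda>x. (u x - (a + b * (x - \<alpha>) + c * (x - \<alpha>)^2))
      + (a + b * (x - \<alpha>) + c * (x - \<alpha>)^2)) \<longlongrightarrow> 0 + a) (at \<alpha> within A)"
    by (rule tendsto_add)
  then show ?thesis by simp
qed

section \<open>Arithmetic of expansions\<close>

lemma expands3_add:
  assumes "expands3 \<alpha> A a b c u" "expands3 \<alpha> A a' b' c' v"
  shows "expands3 \<alpha> A (a + a') (b + b') (c + c') (\<lambda>x. u x + v x)"
  using sum_in_bigo(1)[OF assms[unfolded expands3_def]]
  unfolding expands3_def by (simp add: algebra_simps)

text \<open>With P and Q the two quadratic polynomials, u v - P Q = v (u - P) + P (v - Q), where
  each time a bounded factor meets a cubic error. The terms of P Q of degree three and four form a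
  third cubic error.\<close>

lemma expands3_mult:
  assumes "expands3 \<alpha> A a b c u" "expands3 \<alpha> A a' b' c' v"
  shows "expands3 \<alpha> A (a * a') (a * b' + b * a') (a * c' + b * b' + c * a') (\<lambda>x. u x * v x)"
proof -
  let ?O = "O[at \<alpha> within A](\<lambda>x. (x - \<alpha>)^3)"
  define P where "P = (\<lambda>x. a + b * (x - \<alpha>) + c * (x - \<alpha>)^2)"
  have *: "(\<lambda>x. p x * r x) \<in> ?O" if "(p \<longlongrightarrow> l) (at \<alpha> within A)" "r \<in> ?O" for p r l
    using landau_o.big.mult[OF bigo_one_of_tendsto[OF that(1)] that(2)] by simp
  have 1: "(\<lambda>x. v x * (u x - P x)) \<in> ?O"
    by (rule *[OF expands3_tendsto[OF assms(2)]]) (use assms(1) in \<open>simp add: expands3_def P_def\<close>)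
  have "(P \<longlongrightarrow> a) (at \<alpha> within A)"
    unfolding P_def by (auto intro!: tendsto_eq_intros)
  then have 2: "(\<lambda>x. P x * (v x - (a' + b' * (x - \<alpha>) + c' * (x - \<alpha>)^2))) \<in> ?O"
    by (rule *) (use assms(2) in \<open>simp add: expands3_def\<close>)
  have 3: "(\<lambda>x. (b * c' + c * b' + c * c' * (x - \<alpha>)) * (x - \<alpha>)^3) \<in> ?O"
    by (rule *[where l = "b * c' + c * b'"]) (auto intro!: tendsto_eq_intros)
  show ?thesis
    using sum_in_bigo(1)[OF sum_in_bigo(1)[OF 1 2] 3]
    unfolding expands3_def P_def
    by (simp add: algebra_simps power2_eq_square power3_eq_cube)
qed

text \<open>The coefficients are those of the truncated reciprocal series \<open>p\<close>. By the
  product rule u p - 1 is of cubic order, and multiplying by the bounded function -1/u turns it into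
  1/u - p.\<close>

lemma expands3_inverse:
  assumes u: "expands3 \<alpha> A a b c u" and a: "a \<noteq> 0"
  shows "expands3 \<alpha> A (1 / a) (- b / a^2) (b^2 / a^3 - c / a^2) (\<lambda>x. 1 / u x)"
proof -
  let ?O = "O[at \<alpha> within A](\<lambda>x. (x - \<alpha>)^3)"
  define p where "p = (\<lambda>x. 1 / a + (- b / a^2) * (x - \<alpha>) + (b^2 / a^3 - c / a^2) * (x - \<alpha>)^2)"
  have p: "expands3 \<alpha> A (1 / a) (- b / a^2) (b^2 / a^3 - c / a^2) p"
    by (simp add: expands3_def p_def)
  have u0: "(u \<longlongrightarrow> a) (at \<alpha> within A)" by (rule expands3_tendsto[OF u])
  have "(\<lambda>x. u x * p x - 1) \<in> ?O"
    using expands3_mult[OF u p] a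
    by (simp add: expands3_def field_simps power2_eq_square power3_eq_cube)
  then have "(\<lambda>x. (- (1 / u x)) * (u x * p x - 1)) \<in> ?O"
    using landau_o.big.mult[OF bigo_one_of_tendsto[of "\<lambda>x. - (1 / u x)" "- (1 / a)" "at \<alpha> within A"]]
    using u0 a by (force intro!: tendsto_intros)
  moreover have "\<forall>\<^sub>F x in at \<alpha> within A. u x \<noteq> 0"
    using tendsto_imp_eventually_ne[OF u0 a] .
  then have "\<forall>\<^sub>F x in at \<alpha> within A. (- (1 / u x)) * (u x * p x - 1) = 1 / u x - p x"
    by eventually_elim (simp add: field_simps)
  ultimately show ?thesis
    unfolding expands3_def p_def by (subst (asm) landau_o.big.in_cong) auto
qed

text \<open>The equalities of coefficients are separate premises, so that the coefficients produced
  by the arithmetic rules can be simplified afterwards.\<close>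

lemma expands_cong:
  assumes "expands \<alpha> A a b u" "\<forall>\<^sub>F x in at \<alpha> within A. u x = v x" "a = a'" "b = b'"
  shows "expands \<alpha> A a' b' v"
proof -
  have "\<forall>\<^sub>F x in at \<alpha> within A. u x - (a + b * (x - \<alpha>) + c * (x - \<alpha>)^2) =
      v x - (a + b * (x - \<alpha>) + c * (x - \<alpha>)^2)" for c
    using assms(2) by eventually_elim simp
  from landau_o.big.in_cong[OF this] show ?thesis
    using assms by (auto simp: expands_def expands3_def)
qed

lemma expands_tendsto: "expands \<alpha> A a b u \<Longrightarrow> (u \<longlongrightarrow> a) (at \<alpha> within A)"
  by (auto simp: expands_def intro: expands3_tendsto)

lemma expands_const: "expands \<alpha> A k 0 (\<lambda>_. k)"
  unfolding expands_def expands3_def by (rule exI[of _ 0]) simp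

lemma expands_err: "expands \<alpha> A 0 1 (\<lambda>x. x - \<alpha>)"
  unfolding expands_def expands3_def by (rule exI[of _ 0]) simp

lemma expands_bigo:
  "u \<in> O[at \<alpha> within A](\<lambda>x. (x - \<alpha>)^3) \<Longrightarrow> expands \<alpha> A 0 0 u"
  unfolding expands_def expands3_def by (rule exI[of _ 0]) simp

lemma expands_add:
  "expands \<alpha> A a b u \<Longrightarrow> expands \<alpha> A a' b' v \<Longrightarrow> expands \<alpha> A (a + a') (b + b') (\<lambda>x. u x + v x)"
  by (auto simp: expands_def intro: expands3_add)

lemma expands_mult:
  "expands \<alpha> A a b u \<Longrightarrow> expands \<alpha> A a' b' v \<Longrightarrow>
    expands \<alpha> A (a * a') (a * b' + b * a') (\<lambda>x. u x * v x)"
  by (auto simp: expands_def intro: expands3_mult)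

lemma expands_cmult: "expands \<alpha> A a b u \<Longrightarrow> expands \<alpha> A (k * a) (k * b) (\<lambda>x. k * u x)"
  using expands_mult[OF expands_const[of \<alpha> A k]] by simp

lemma expands_diff:
  "expands \<alpha> A a b u \<Longrightarrow> expands \<alpha> A a' b' v \<Longrightarrow> expands \<alpha> A (a - a') (b - b') (\<lambda>x. u x - v x)"
  using expands_add[OF _ expands_cmult[of \<alpha> A a' b' v "-1"]] by simp

lemma expands_divide:
  assumes "expands \<alpha> A a b u" "expands \<alpha> A a' b' v" "a' \<noteq> 0"
  shows "expands \<alpha> A (a / a') ((b - a * b' / a') / a') (\<lambda>x. u x / v x)"
proof -
  have "expands \<alpha> A (1 / a') (- b' / a'^2) (\<lambda>x. 1 / v x)"
    using assms(2) expands3_inverse[OF _ assms(3)] unfolding expands_def by blast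
  from expands_mult[OF assms(1) this] show ?thesis
    by (rule expands_cong) (auto simp: field_simps power2_eq_square assms(3) intro!: always_eventually)
qed

lemma expands_sum:
  "(\<And>i. i \<in> I \<Longrightarrow> expands \<alpha> A (a i) (b i) (u i)) \<Longrightarrow>
    expands \<alpha> A (\<Sum>i\<in>I. a i) (\<Sum>i\<in>I. b i) (\<lambda>x. \<Sum>i\<in>I. u i x)"
proof (induction I rule: infinite_finite_induct)
  case (insert i I)
  then show ?case using expands_add[of \<alpha> A "a i" "b i" "u i"] by simp
qed (simp_all add: expands_const)

section \<open>Leading terms of products, and local convergence\<close>

lemma expands_0_bigo:
  assumes "expands \<alpha> A 0 b u"
  shows "u \<in> O[at \<alpha> within A](\<lambda>x. x - \<alpha>)"
proof -
  obtain c where c: "(\<lambda>x. u x - (b * (x - \<alpha>) + c * (x - \<alpha>)^2)) \<in> O[at \<alpha> within A](\<lambda>x. (x - \<alpha>)^3)"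
    using assms by (auto simp: expands_def expands3_def)
  have *: "(\<lambda>x. (x - \<alpha>)^n) \<in> O[at \<alpha> within A](\<lambda>x. x - \<alpha>)" if "n \<ge> 1" for n
    using err_power_mono[OF that] by simp
  have "(\<lambda>x. u x - (b * (x - \<alpha>) + c * (x - \<alpha>)^2)) \<in> O[at \<alpha> within A](\<lambda>x. x - \<alpha>)"
    using c *[of 3] by (rule landau_o.big_trans) simp
  moreover have "(\<lambda>x. b * (x - \<alpha>) + c * (x - \<alpha>)^2) \<in> O[at \<alpha> within A](\<lambda>x. x - \<alpha>)"
    using *[of 2] by (intro sum_in_bigo) auto
  ultimately show ?thesis using sum_in_bigo(1) by fastforce
qed

text \<open>With e = x - \<alpha> the error splits as u (v - l e^n) + l e^n (u - k e^m). Orders of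
  vanishing add up, so a product of several factors is controlled to a high order although each
  factor is known only up to a cubic error.\<close>

lemma leading_terms_mult:
  fixes \<alpha> :: real
  assumes "(\<lambda>x. u x - k * (x - \<alpha>)^m) \<in> O[at \<alpha> within A](\<lambda>x. (x - \<alpha>)^(m + 1))"
    and "(\<lambda>x. v x - l * (x - \<alpha>)^n) \<in> O[at \<alpha> within A](\<lambda>x. (x - \<alpha>)^(n + 1))"
  shows "(\<lambda>x. u x * v x - k * l * (x - \<alpha>)^(m + n)) \<in> O[at \<alpha> within A](\<lambda>x. (x - \<alpha>)^(m + n + 1))"
proof -
  have "(\<lambda>x. u x - k * (x - \<alpha>)^m) \<in> O[at \<alpha> within A](\<lambda>x. (x - \<alpha>)^m)"
    using assms(1) err_power_mono by (rule landau_o.big_trans) simp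
  then have "(\<lambda>x. (u x - k * (x - \<alpha>)^m) + k * (x - \<alpha>)^m) \<in> O[at \<alpha> within A](\<lambda>x. (x - \<alpha>)^m)"
    by (rule sum_in_bigo(1)) simp
  then have u: "u \<in> O[at \<alpha> within A](\<lambda>x. (x - \<alpha>)^m)" by simp
  have 1: "(\<lambda>x. u x * (v x - l * (x - \<alpha>)^n)) \<in> O[at \<alpha> within A](\<lambda>x. (x - \<alpha>)^(m + n + 1))"
    using landau_o.big.mult[OF u assms(2)] by (simp add: power_add algebra_simps)
  have "(\<lambda>x. l * (x - \<alpha>)^n) \<in> O[at \<alpha> within A](\<lambda>x. (x - \<alpha>)^n)" by simp
  from landau_o.big.mult[OF this assms(1)]
  have 2: "(\<lambda>x. l * (x - \<alpha>)^n * (u x - k * (x - \<alpha>)^m)) \<in> O[at \<alpha> within A](\<lambda>x. (x - \<alpha>)^(m + n + 1))"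
    by (simp add: power_add algebra_simps)
  show ?thesis using sum_in_bigo(1)[OF 1 2] by (simp add: power_add algebra_simps)
qed

text \<open>Brings factors of order 0, 1 and 2 into the form that \<open>leading_terms_mult\<close>
  takes. In the last case the coefficient is the hidden quadratic one, hence the
  existential.\<close>

lemma expands_leading:
  shows "expands \<alpha> A a b u \<Longrightarrow>
      (\<lambda>x. u x - a * (x - \<alpha>)^0) \<in> O[at \<alpha> within A](\<lambda>x. (x - \<alpha>)^(0 + 1))"
    and "expands \<alpha> A 0 b u \<Longrightarrow>
      (\<lambda>x. u x - b * (x - \<alpha>)^1) \<in> O[at \<alpha> within A](\<lambda>x. (x - \<alpha>)^(1 + 1))"
    and "expands \<alpha> A 0 0 u \<Longrightarrow>
      \<exists>c. (\<lambda>x. u x - c * (x - \<alpha>)^2) \<in> O[at \<alpha> within A](\<lambda>x. (x - \<alpha>)^(2 + 1))"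
proof -
  show "(\<lambda>x. u x - a * (x - \<alpha>)^0) \<in> O[at \<alpha> within A](\<lambda>x. (x - \<alpha>)^(0 + 1))"
    if "expands \<alpha> A a b u"
    using expands_0_bigo[of \<alpha> A b "\<lambda>x. u x - a"] expands_diff[OF that expands_const[of \<alpha> A a]]
    by simp
next
  assume "expands \<alpha> A 0 b u"
  then obtain c where c: "(\<lambda>x. u x - (b * (x - \<alpha>) + c * (x - \<alpha>)^2)) \<in> O[at \<alpha> within A](\<lambda>x. (x - \<alpha>)^3)"
    by (auto simp: expands_def expands3_def)
  have "(\<lambda>x. u x - (b * (x - \<alpha>) + c * (x - \<alpha>)^2)) \<in> O[at \<alpha> within A](\<lambda>x. (x - \<alpha>)^2)"
    using c err_power_mono by (rule landau_o.big_trans) simp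
  then have "(\<lambda>x. (u x - (b * (x - \<alpha>) + c * (x - \<alpha>)^2)) + c * (x - \<alpha>)^2) \<in> O[at \<alpha> within A](\<lambda>x. (x - \<alpha>)^2)"
    by (rule sum_in_bigo(1)) simp
  then show "(\<lambda>x. u x - b * (x - \<alpha>)^1) \<in> O[at \<alpha> within A](\<lambda>x. (x - \<alpha>)^(1 + 1))"
    by (simp add: diff_diff_eq[symmetric] power2_eq_square)
next
  show "\<exists>c. (\<lambda>x. u x - c * (x - \<alpha>)^2) \<in> O[at \<alpha> within A](\<lambda>x. (x - \<alpha>)^(2 + 1))"
    if "expands \<alpha> A 0 0 u"
    using that by (auto simp: expands_def expands3_def)
qed

text \<open>The error after a step is at most C e^2, so once C |e| < 1/2 every step at least halves
  the error. The condition \<alpha> \<notin> \<open>A\<close> enters because the expansion says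
  nothing about \<Phi> at \<alpha>.\<close>

lemma order_ge_2_locally_convergent:
  assumes "convergence_order_ge p \<Phi> A \<alpha>" "p \<ge> 2" "\<alpha> \<notin> A"
  shows "locally_convergent \<Phi> A \<alpha>"
proof -
  obtain K where "(\<lambda>x. (\<Phi> x - \<alpha>) - K * (x - \<alpha>)^p) \<in> O[at \<alpha> within A](\<lambda>x. (x - \<alpha>)^(p + 1))"
    using assms(1) by (auto simp: convergence_order_ge_def)
  then have 1: "(\<lambda>x. (\<Phi> x - \<alpha>) - K * (x - \<alpha>)^p) \<in> O[at \<alpha> within A](\<lambda>x. (x - \<alpha>)^2)"
    using err_power_mono by (rule landau_o.big_trans) (use assms(2) in simp)
  have 2: "(\<lambda>x. K * (x - \<alpha>)^p) \<in> O[at \<alpha> within A](\<lambda>x. (x - \<alpha>)^2)"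
    using err_power_mono[OF assms(2)] by simp
  from sum_in_bigo(1)[OF 1 2] have "(\<lambda>x. \<Phi> x - \<alpha>) \<in> O[at \<alpha> within A](\<lambda>x. (x - \<alpha>)^2)"
    by simp
  then obtain C where C: "C > 0"
    "\<forall>\<^sub>F x in at \<alpha> within A. norm (\<Phi> x - \<alpha>) \<le> C * norm ((x - \<alpha>)^2)"
    by (elim landau_o.bigE)
  have "((\<lambda>x. C * \<bar>x - \<alpha>\<bar>) \<longlongrightarrow> 0) (at \<alpha> within A)"
    by (auto intro!: tendsto_eq_intros)
  then have "\<forall>\<^sub>F x in at \<alpha> within A. C * \<bar>x - \<alpha>\<bar> < 1 / 2"
    by (rule order_tendstoD(2)) simp
  with C(2) have "\<forall>\<^sub>F x in at \<alpha> within A. \<bar>\<Phi> x - \<alpha>\<bar> \<le> \<bar>x - \<alpha>\<bar> / 2"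
  proof eventually_elim
    case (elim x)
    have "C * (\<bar>x - \<alpha>\<bar> * \<bar>x - \<alpha>\<bar>) \<le> 1 / 2 * \<bar>x - \<alpha>\<bar>"
      using mult_right_mono[OF less_imp_le[OF elim(2)], of "\<bar>x - \<alpha>\<bar>"] by simp
    then show ?case using elim(1) by (simp add: power2_eq_square abs_mult)
  qed
  then obtain \<delta> where \<delta>: "\<delta> > 0"
    "\<And>x. x \<in> A \<Longrightarrow> \<bar>x - \<alpha>\<bar> < \<delta> \<Longrightarrow> \<bar>\<Phi> x - \<alpha>\<bar> \<le> \<bar>x - \<alpha>\<bar> / 2"
    using assms(3) by (force simp: eventually_at dist_real_def)
  show ?thesis
    unfolding locally_convergent_def
  proof (intro exI[of _ \<delta>] conjI allI impI \<delta>(1))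
    fix x :: "nat \<Rightarrow> real"
    assume x: "\<bar>x 0 - \<alpha>\<bar> < \<delta> \<and> (\<forall>n. x n \<in> A \<and> x (Suc n) = \<Phi> (x n))"
    \<comment> \<open>The first conjunct is the geometric decay; the second keeps the orbit where
      the halving estimate applies.\<close>
    have bound: "\<bar>x n - \<alpha>\<bar> \<le> \<delta> * (1 / 2)^n \<and> \<bar>x n - \<alpha>\<bar> < \<delta>" for n
    proof (induction n)
      case (Suc n)
      have "\<bar>x (Suc n) - \<alpha>\<bar> \<le> \<bar>x n - \<alpha>\<bar> / 2" using x Suc \<delta>(2) by metis
      also have "\<bar>x n - \<alpha>\<bar> / 2 \<le> \<delta> * (1 / 2)^Suc n" using Suc by simp
      finally have "\<bar>x (Suc n) - \<alpha>\<bar> \<le> \<delta> * (1 / 2)^Suc n" .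
      moreover have "\<bar>x n - \<alpha>\<bar> / 2 \<le> \<bar>x n - \<alpha>\<bar>" by simp
      then have "\<bar>x (Suc n) - \<alpha>\<bar> < \<delta>"
        using \<open>\<bar>x (Suc n) - \<alpha>\<bar> \<le> \<bar>x n - \<alpha>\<bar> / 2\<close> Suc
        by (meson le_less_trans)
      ultimately show ?case by blast
    qed (use x in simp)
    have "(\<lambda>n. \<delta> * (1 / 2)^n) \<longlonglongrightarrow> 0"
      by (intro tendsto_mult_right_zero LIMSEQ_power_zero) simp
    then have "(\<lambda>n. x n - \<alpha>) \<longlonglongrightarrow> 0"
      by (rule Lim_null_comparison[rotated]) (use bound in \<open>auto intro: always_eventually\<close>)
    then show "x \<longlonglongrightarrow> \<alpha>" using LIM_zero_iff by blast
  qed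
qed

section \<open>Taylor expansion of weight functions\<close>

lemma iter_partial_Nil [simp]: "iter_partial [] f = f"
  by (simp add: iter_partial_def)

lemma iter_partial_Cons:
  "iter_partial (v # vs) f = (\<lambda>x. frechet_derivative (iter_partial vs f) (at x) v)"
  by (simp add: iter_partial_def)

text \<open>The derivative is linear, so expanding the direction in the basis leaves only partial
  derivatives; the new direction goes to the head of the list, being the last
  differentiation.\<close>

lemma Ck_on_has_derivative:
  assumes "Ck_on k f U" "x \<in> U" "set vs \<subseteq> Basis" "length vs < k"
  shows "(iter_partial vs f has_derivative
    (\<lambda>v. \<Sum>b\<in>Basis. (v \<bullet> b) * iter_partial (b # vs) f x)) (at x)"
proof -
  have d: "(iter_partial vs f has_derivative frechet_derivative (iter_partial vs f) (at x)) (at x)"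
    using assms by (auto simp: Ck_on_def frechet_derivative_works)
  then have lin: "linear (frechet_derivative (iter_partial vs f) (at x))"
    by (rule has_derivative_linear)
  have "frechet_derivative (iter_partial vs f) (at x) v =
      (\<Sum>b\<in>Basis. (v \<bullet> b) * iter_partial (b # vs) f x)" for v
  proof -
    have "frechet_derivative (iter_partial vs f) (at x) (\<Sum>b\<in>Basis. (v \<bullet> b) *\<^sub>R b) =
      (\<Sum>b\<in>Basis. (v \<bullet> b) * iter_partial (b # vs) f x)"
      by (simp add: linear_sum[OF lin] linear_cmul[OF lin] iter_partial_Cons)
    then show ?thesis by (simp add: euclidean_representation)
  qed
  then have "frechet_derivative (iter_partial vs f) (at x) =
      (\<lambda>v. \<Sum>b\<in>Basis. (v \<bullet> b) * iter_partial (b # vs) f x)"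
    by blast
  with d show ?thesis by simp
qed

text \<open>The chain rule on a line through the origin, which reduces Taylor's formula in several
  variables to the one-variable case.\<close>

lemma Ck_on_ray_derivative:
  assumes "Ck_on k f U" "s *\<^sub>R v \<in> U" "set vs \<subseteq> Basis" "length vs < k"
  shows "((\<lambda>s. iter_partial vs f (s *\<^sub>R v)) has_real_derivative
    (\<Sum>b\<in>Basis. (v \<bullet> b) * iter_partial (b # vs) f (s *\<^sub>R v))) (at s)"
proof -
  have "((\<lambda>s. s *\<^sub>R v) has_derivative (\<lambda>h. h *\<^sub>R v)) (at s)"
    by (auto intro!: derivative_eq_intros)
  from diff_chain_at[OF this Ck_on_has_derivative[OF assms]]
  show ?thesis
    by (simp add: o_def has_field_derivative_def mult_commute_abs mult.assoc flip: sum_distrib_left)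
qed

text \<open>Maclaurin's formula with Lagrange remainder for s \<mapsto> W (s v) on [0,1]. The third
  derivative is a cubic form in \<open>v\<close> whose coefficients are bounded on a compact
  ball.\<close>

lemma taylor2_bound:
  fixes W :: "'a::euclidean_space \<Rightarrow> real"
  assumes C3: "Ck_on 3 W U" and "open U" "0 \<in> U"
  obtains r C where "r > 0" "\<And>v. norm v < r \<Longrightarrow>
    \<bar>W v - (W 0 + (\<Sum>b\<in>Basis. (v \<bullet> b) * iter_partial [b] W 0)
      + (\<Sum>b\<in>Basis. \<Sum>c\<in>Basis. (v \<bullet> b) * (v \<bullet> c) * (iter_partial [c, b] W 0 / 2)))\<bar> \<le> C * norm v ^ 3"
proof -
  obtain r where r: "r > 0" "cball 0 r \<subseteq> U"
    using open_contains_cball \<open>open U\<close> \<open>0 \<in> U\<close> by blast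
  \<comment> \<open>Summing the moduli of all third partials gives one continuous function, so a
    single constant serves every direction.\<close>
  define T where "T = (\<lambda>x. \<Sum>b\<in>Basis. \<Sum>c\<in>Basis. \<Sum>d\<in>Basis. \<bar>iter_partial [d, c, b] W x\<bar>)"
  have "continuous_on (cball 0 r) (iter_partial [d, c, b] W)"
    if "b \<in> Basis" "c \<in> Basis" "d \<in> Basis" for b c d
    using C3[unfolded Ck_on_def, rule_format, of "[d, c, b]"] that r(2)
    by (auto intro: continuous_on_subset)
  then have "continuous_on (cball 0 r) T"
    unfolding T_def by (intro continuous_intros) auto
  then have "bounded (T ` cball 0 r)"
    using compact_cball compact_continuous_image compact_imp_bounded by blast
  then obtain C where C: "\<And>x. x \<in> cball 0 r \<Longrightarrow> \<bar>T x\<bar> \<le> C"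
    unfolding bounded_iff by (metis imageI real_norm_def)
  show ?thesis
  proof (rule that[of r C])
    fix v :: 'a assume v: "norm v < r"
    \<comment> \<open>\<open>\<phi> n\<close> is the n-th derivative of s \<mapsto> W (s v); the
      last branch is the third one.\<close>
    define \<phi> where "\<phi> = (\<lambda>(n::nat) s. if n = 0 then W (s *\<^sub>R v)
      else if n = 1 then \<Sum>b\<in>Basis. (v \<bullet> b) * iter_partial [b] W (s *\<^sub>R v)
      else if n = 2 then \<Sum>b\<in>Basis. \<Sum>c\<in>Basis. (v \<bullet> b) * (v \<bullet> c) * iter_partial [c, b] W (s *\<^sub>R v)
      else \<Sum>b\<in>Basis. \<Sum>c\<in>Basis. \<Sum>d\<in>Basis. (v \<bullet> b) * (v \<bullet> c) * (v \<bullet> d) * iter_partial [d, c, b] W (s *\<^sub>R v))"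
    have inU: "s *\<^sub>R v \<in> cball 0 r" if "0 \<le> s" "s \<le> 1" for s
      using that v mult_mono[of s 1 "norm v" r] r(1) by simp
    have deriv: "(\<phi> m has_real_derivative \<phi> (Suc m) s) (at s)" if "m < 3" "0 \<le> s" "s \<le> 1" for m s
    proof -
      have U: "s *\<^sub>R v \<in> U" using inU that r(2) by blast
      note D = Ck_on_ray_derivative[OF C3 U]
      from \<open>m < 3\<close> consider "m = 0" | "m = 1" | "m = 2" by linarith
      then show ?thesis
      proof cases
        case 1 then show ?thesis using D[of "[]"] by (simp add: \<phi>_def)
      next
        case 2
        show ?thesis unfolding 2 \<phi>_def
          by (auto intro!: derivative_eq_intros D[THEN DERIV_cong] sum.cong
              simp: sum_distrib_left mult_ac)
      next
        case 3
        show ?thesis unfolding 3 \<phi>_def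
          by (auto intro!: derivative_eq_intros D[THEN DERIV_cong] sum.cong
              simp: sum_distrib_left mult_ac)
      qed
    qed
    obtain s where s: "0 < s" "s < 1"
      "\<phi> 0 1 = (\<Sum>m<3. \<phi> m 0 / fact m * 1 ^ m) + \<phi> 3 s / fact 3 * 1 ^ 3"
      using Maclaurin[of 1 3 \<phi> "\<phi> 0"] deriv by auto
    have eq: "W v - (W 0 + (\<Sum>b\<in>Basis. (v \<bullet> b) * iter_partial [b] W 0)
      + (\<Sum>b\<in>Basis. \<Sum>c\<in>Basis. (v \<bullet> b) * (v \<bullet> c) * (iter_partial [c, b] W 0 / 2))) = \<phi> 3 s / 6"
      using s(3) by (simp add: \<phi>_def numeral_3_eq_3 fact_numeral sum_divide_distrib)
    have "\<bar>\<phi> 3 s\<bar> \<le> (\<Sum>b\<in>Basis. \<Sum>c\<in>Basis. \<Sum>d\<in>Basis. norm v ^ 3 * \<bar>iter_partial [d, c, b] W (s *\<^sub>R v)\<bar>)"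
      unfolding \<phi>_def
      by (auto intro!: order.trans[OF sum_abs] sum_mono mult_right_mono mult_mono Basis_le_norm
          simp: abs_mult power3_eq_cube)
    also have "\<dots> = norm v ^ 3 * T (s *\<^sub>R v)"
      by (simp add: T_def sum_distrib_left)
    also have "\<dots> \<le> norm v ^ 3 * C"
      using C[OF inU, of s] s by (intro mult_left_mono) auto
    finally have "\<bar>\<phi> 3 s / 6\<bar> \<le> C * norm v ^ 3" by (simp add: mult.commute)
    then show "\<bar>W v - (W 0 + (\<Sum>b\<in>Basis. (v \<bullet> b) * iter_partial [b] W 0)
      + (\<Sum>b\<in>Basis. \<Sum>c\<in>Basis. (v \<bullet> b) * (v \<bullet> c) * (iter_partial [c, b] W 0 / 2)))\<bar> \<le> C * norm v ^ 3"
      unfolding eq .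
  qed (rule r(1))
qed

text \<open>The constant coefficient is fixed to 0 because the arguments of the weights tend to the
  origin; \<beta> collects the linear coefficients of the components.\<close>

definition expands_vec :: "real \<Rightarrow> real set \<Rightarrow> 'a::euclidean_space \<Rightarrow> (real \<Rightarrow> 'a) \<Rightarrow> bool" where
  "expands_vec \<alpha> A \<beta> t \<longleftrightarrow> (\<forall>b\<in>Basis. expands \<alpha> A 0 (\<beta> \<bullet> b) (\<lambda>x. t x \<bullet> b))"

lemma expands_vec_real: "expands_vec \<alpha> A \<beta> t \<longleftrightarrow> expands \<alpha> A 0 \<beta> t"
  by (simp add: expands_vec_def)

lemma expands_vec_Pair:
  "expands \<alpha> A 0 \<beta> s \<Longrightarrow> expands_vec \<alpha> A \<gamma> t \<Longrightarrow> expands_vec \<alpha> A (\<beta>, \<gamma>) (\<lambda>x. (s x, t x))"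
  by (auto simp: expands_vec_def Basis_prod_def)

lemma expands_vec_bigo:
  assumes "expands_vec \<alpha> A \<beta> t"
  shows "(\<lambda>x. norm (t x)) \<in> O[at \<alpha> within A](\<lambda>x. x - \<alpha>)"
proof -
  have "(\<lambda>x. \<Sum>b\<in>Basis. \<bar>t x \<bullet> b\<bar>) \<in> O[at \<alpha> within A](\<lambda>x. x - \<alpha>)"
    using assms expands_0_bigo by (intro big_sum_in_bigo) (auto simp: expands_vec_def)
  moreover have "(\<lambda>x. norm (t x)) \<in> O[at \<alpha> within A](\<lambda>x. \<Sum>b\<in>Basis. \<bar>t x \<bullet> b\<bar>)"
    by (rule bigoI[of _ 1]) (auto intro!: always_eventually norm_le_l1 simp: sum_nonneg abs_of_nonneg)
  ultimately show ?thesis by (rule landau_o.big_trans[rotated])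
qed

text \<open>The quadratic Taylor polynomial of \<open>W\<close> is composed with \<open>t\<close> by
  the arithmetic rules, and the Taylor remainder, at most C |t|^3, is of cubic order because t = O(x
  - \<alpha>).\<close>

lemma expands_weight:
  fixes W :: "'a::euclidean_space \<Rightarrow> real"
  assumes "weight_fun W" and t: "expands_vec \<alpha> A \<beta> t"
  shows "expands \<alpha> A (W 0) (frechet_derivative W (at 0) \<beta>) (\<lambda>x. W (t x))"
proof -
  obtain U where U: "open U" "0 \<in> U" "Ck_on 3 W U"
    using assms(1) by (auto simp: weight_fun_def smooth_near_def)
  define P where "P = (\<lambda>v. W 0 + (\<Sum>b\<in>Basis. (v \<bullet> b) * iter_partial [b] W 0)
      + (\<Sum>b\<in>Basis. \<Sum>c\<in>Basis. (v \<bullet> b) * (v \<bullet> c) * (iter_partial [c, b] W 0 / 2)))"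
  obtain r C where r: "r > 0" and C: "\<And>v. norm v < r \<Longrightarrow> \<bar>W v - P v\<bar> \<le> C * norm v ^ 3"
    using taylor2_bound[OF U(3,1,2)] unfolding P_def by blast
  have "(W has_derivative (\<lambda>v. \<Sum>b\<in>Basis. (v \<bullet> b) * iter_partial [b] W 0)) (at 0)"
    using Ck_on_has_derivative[OF U(3,2), of "[]"] by simp
  then have "frechet_derivative W (at 0) \<beta> = (\<Sum>b\<in>Basis. (\<beta> \<bullet> b) * iter_partial [b] W 0)"
    by (simp flip: frechet_derivative_at)
  moreover have comp: "expands \<alpha> A 0 (\<beta> \<bullet> b) (\<lambda>x. t x \<bullet> b)" if "b \<in> Basis" for b
    using t that by (auto simp: expands_vec_def)
  \<comment> \<open>The sums of zeros are left standing so that the goal has the shape produced by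
    the rules for sums.\<close>
  have "expands \<alpha> A (W 0 + (\<Sum>b\<in>(Basis::'a set). 0) + (\<Sum>b\<in>(Basis::'a set). \<Sum>c\<in>(Basis::'a set). 0))
      (0 + (\<Sum>b\<in>Basis. (\<beta> \<bullet> b) * iter_partial [b] W 0) + (\<Sum>b\<in>(Basis::'a set). \<Sum>c\<in>(Basis::'a set). 0))
      (\<lambda>x. P (t x))"
    unfolding P_def
  proof (intro expands_add expands_sum expands_const)
    fix b c :: 'a assume b: "b \<in> Basis"
    show "expands \<alpha> A 0 ((\<beta> \<bullet> b) * iter_partial [b] W 0) (\<lambda>x. (t x \<bullet> b) * iter_partial [b] W 0)"
      using expands_cmult[OF comp[OF b], of "iter_partial [b] W 0"] by (simp add: mult.commute)
    assume c: "c \<in> Basis"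
    \<comment> \<open>A product of two components that vanish at \<alpha> has no linear
      term.\<close>
    show "expands \<alpha> A 0 0 (\<lambda>x. (t x \<bullet> b) * (t x \<bullet> c) * (iter_partial [c, b] W 0 / 2))"
      using expands_mult[OF expands_mult[OF comp[OF b] comp[OF c]] expands_const[of \<alpha> A "iter_partial [c, b] W 0 / 2"]] by simp
  qed
  moreover have "(\<lambda>x. W (t x) - P (t x)) \<in> O[at \<alpha> within A](\<lambda>x. (x - \<alpha>)^3)"
  proof -
    have small: "(\<lambda>x. norm (t x)) \<in> O[at \<alpha> within A](\<lambda>x. x - \<alpha>)"
      by (rule expands_vec_bigo[OF t])
    then obtain B where "\<forall>\<^sub>F x in at \<alpha> within A. norm (norm (t x)) \<le> B * norm (x - \<alpha>)"
      by (elim landau_o.bigE)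
    moreover have "((\<lambda>x. B * norm (x - \<alpha>)) \<longlongrightarrow> 0) (at \<alpha> within A)"
      by (auto intro!: tendsto_eq_intros)
    ultimately have "((\<lambda>x. norm (t x)) \<longlongrightarrow> 0) (at \<alpha> within A)"
      by (rule Lim_null_comparison)
    then have "\<forall>\<^sub>F x in at \<alpha> within A. norm (t x) < r"
      using r by (auto dest: order_tendstoD(2))
    then have "\<forall>\<^sub>F x in at \<alpha> within A. norm (W (t x) - P (t x)) \<le> C * norm (norm (t x) ^ 3)"
      by eventually_elim (use C in auto)
    then have "(\<lambda>x. W (t x) - P (t x)) \<in> O[at \<alpha> within A](\<lambda>x. norm (t x) ^ 3)"
      by (rule bigoI)
    also have "(\<lambda>x. norm (t x) ^ 3) \<in> O[at \<alpha> within A](\<lambda>x. (x - \<alpha>)^3)"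
      by (rule landau_o.big_power[OF small])
    finally show ?thesis .
  qed
  ultimately show ?thesis
    using expands_add[OF _ expands_bigo, of \<alpha> A _ _ "\<lambda>x. P (t x)" "\<lambda>x. W (t x) - P (t x)"]
    by simp
qed

lemma weight_fun_differentiable: "weight_fun W \<Longrightarrow> W differentiable (at 0)"
proof -
  assume "weight_fun W"
  then obtain U where "0 \<in> U" "Ck_on 1 W U"
    by (auto simp: weight_fun_def smooth_near_def)
  then show ?thesis
    using Ck_on_has_derivative[of 1 W U 0 "[]"] by (auto simp: differentiable_def)
qed

text \<open>Connects the prescribed partial derivatives, given as one-variable derivatives along a
  ray, with the total derivative: both differentiate the same restriction, and derivatives are
  unique.\<close>

lemma frechet_derivative_ray:
  assumes "weight_fun W" "((\<lambda>t. W (t *\<^sub>R v)) has_real_derivative d) (at 0)"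
  shows "frechet_derivative W (at 0) (s *\<^sub>R v) = s * d"
proof -
  have W: "(W has_derivative frechet_derivative W (at 0)) (at 0)"
    using weight_fun_differentiable[OF assms(1)] by (simp add: frechet_derivative_works)
  have ray: "((\<lambda>t. t *\<^sub>R v) has_derivative (\<lambda>h. h *\<^sub>R v)) (at 0)"
    by (auto intro!: derivative_eq_intros)
  have "((\<lambda>t. W (t *\<^sub>R v)) has_derivative (\<lambda>h. frechet_derivative W (at 0) (h *\<^sub>R v))) (at 0)"
    using diff_chain_at[OF ray, of W "frechet_derivative W (at 0)"] W by (simp add: o_def)
  moreover have "((\<lambda>t. W (t *\<^sub>R v)) has_derivative (\<lambda>h. d * h)) (at 0)"
    using assms(2) by (simp add: has_field_derivative_def)
  ultimately have "(\<lambda>h. frechet_derivative W (at 0) (h *\<^sub>R v)) = (\<lambda>h. d * h)"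
    by (rule has_derivative_unique)
  then show ?thesis by (metis mult.commute)
qed

text \<open>By linearity two directions suffice when the linear part of the arguments lies in their
  span. This is the situation of \<open>G2\<close> and \<open>S5\<close>, where only
  \<open>t1\<close> and \<open>t2\<close> have linear terms.\<close>

lemma expands_weight_ray2:
  fixes W :: "'a::euclidean_space \<Rightarrow> real"
  assumes "weight_fun W"
    and "((\<lambda>t. W (t *\<^sub>R v)) has_real_derivative d) (at 0)"
    and "((\<lambda>t. W (t *\<^sub>R v')) has_real_derivative d') (at 0)"
    and "expands_vec \<alpha> A (s *\<^sub>R v + s' *\<^sub>R v') t"
  shows "expands \<alpha> A (W 0) (s * d + s' * d') (\<lambda>x. W (t x))"
proof -
  have "linear (frechet_derivative W (at 0))"
    using weight_fun_differentiable[OF assms(1)] by (rule linear_frechet_derivative)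
  then have "frechet_derivative W (at 0) (s *\<^sub>R v + s' *\<^sub>R v') = s * d + s' * d'"
    using frechet_derivative_ray[OF assms(1,2)] frechet_derivative_ray[OF assms(1,3)]
    by (simp add: linear_add)
  then show ?thesis using expands_weight[OF assms(1,4)] by simp
qed

lemma expands_weight_ray:
  assumes "weight_fun W" "((\<lambda>t. W (t *\<^sub>R v)) has_real_derivative d) (at 0)"
    and "expands_vec \<alpha> A (s *\<^sub>R v) t"
  shows "expands \<alpha> A (W 0) (s * d) (\<lambda>x. W (t x))"
  using expands_weight_ray2[OF assms(1,2,2), of \<alpha> A s 0 t] assms(3) by simp

section \<open>Divided differences near a simple root\<close>

text \<open>The mean value inequality on the ball of radius |x - \<alpha>|, where the bound on the
  derivative is largest at the boundary. Each application gains one power of x - \<alpha> and keeps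
  the constant.\<close>

lemma deriv_power_bound:
  fixes g :: "real \<Rightarrow> real"
  assumes g: "\<And>x. \<bar>x - \<alpha>\<bar> \<le> r \<Longrightarrow> (g has_real_derivative g' x) (at x)"
    and "\<And>x. \<bar>x - \<alpha>\<bar> \<le> r \<Longrightarrow> \<bar>g' x\<bar> \<le> B * \<bar>x - \<alpha>\<bar> ^ n"
    and "g \<alpha> = 0" and x: "\<bar>x - \<alpha>\<bar> \<le> r"
  shows "\<bar>g x\<bar> \<le> B * \<bar>x - \<alpha>\<bar> ^ Suc n"
proof -
  \<comment> \<open>Monotonicity of the bound in |z - \<alpha>| needs this sign; at x = \<alpha> the
    claim is trivial.\<close>
  have B: "B \<ge> 0" if "x \<noteq> \<alpha>"
  proof -
    have "0 \<le> \<bar>g' x\<bar>" by simp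
    also have "\<dots> \<le> B * \<bar>x - \<alpha>\<bar> ^ n" using assms(2) x .
    finally have "0 \<le> B * \<bar>x - \<alpha>\<bar> ^ n" .
    moreover have "0 < \<bar>x - \<alpha>\<bar> ^ n" using that by simp
    ultimately show ?thesis by (meson mult_neg_pos not_le)
  qed
  have "norm (g x - g \<alpha>) \<le> (B * \<bar>x - \<alpha>\<bar> ^ n) * norm (x - \<alpha>)" if "x \<noteq> \<alpha>"
  proof (rule field_differentiable_bound[where S = "cball \<alpha> \<bar>x - \<alpha>\<bar>" and f' = g'])
    fix z assume "z \<in> cball \<alpha> \<bar>x - \<alpha>\<bar>"
    then have z: "\<bar>z - \<alpha>\<bar> \<le> \<bar>x - \<alpha>\<bar>" by (simp add: dist_real_def abs_minus_commute)
    with x show "(g has_real_derivative g' z) (at z within cball \<alpha> \<bar>x - \<alpha>\<bar>)"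
      using g by (intro DERIV_subset[OF g]) auto
    have "\<bar>g' z\<bar> \<le> B * \<bar>z - \<alpha>\<bar> ^ n" using assms(2) z x by simp
    also have "\<dots> \<le> B * \<bar>x - \<alpha>\<bar> ^ n" using B that z by (intro mult_left_mono power_mono) auto
    finally show "norm (g' z) \<le> B * \<bar>x - \<alpha>\<bar> ^ n" by simp
  qed (auto simp: dist_real_def)
  then show ?thesis using \<open>g \<alpha> = 0\<close> by (cases "x = \<alpha>") (auto simp: mult_ac)
qed

text \<open>The cofactor of x - \<alpha> is a quadratic polynomial plus \<open>q\<close>. A
  pointwise bound on \<open>q\<close> would not control its divided differences, so a Lipschitz
  estimate is proved: the derivative of \<open>q\<close> is O((x - \<alpha>)^2), and the mean value
  inequality applies.\<close>

lemma simple_root_factor: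
  fixes f :: "real \<Rightarrow> real"
  assumes "open D" "Ck_on 4 f D" "\<alpha> \<in> D" "f \<alpha> = 0"
  obtains r C d2 d3 q where "r > 0"
    "\<And>x. \<bar>x - \<alpha>\<bar> \<le> r \<Longrightarrow>
      f x = (x - \<alpha>) * (deriv f \<alpha> + d2 * (x - \<alpha>) + d3 * (x - \<alpha>)^2 + q x)"
    "q \<alpha> = 0"
    "\<And>u v. \<bar>u - \<alpha>\<bar> \<le> r \<Longrightarrow> \<bar>v - \<alpha>\<bar> \<le> r \<Longrightarrow>
      \<bar>q u - q v\<bar> \<le> C * (\<bar>u - \<alpha>\<bar> + \<bar>v - \<alpha>\<bar>)^2 * \<bar>u - v\<bar>"
proof -
  obtain r where r: "r > 0" "cball \<alpha> r \<subseteq> D"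
    using open_contains_cball assms(1,3) by blast
  define F where "F = (\<lambda>n. iter_partial (replicate n 1) f)"
  have dF: "(F n has_real_derivative F (Suc n) x) (at x)" if "\<bar>x - \<alpha>\<bar> \<le> r" "n < 4" for n x
  proof -
    have "x \<in> D" using that r(2) by (auto simp: dist_real_def abs_minus_commute subset_iff)
    from Ck_on_has_derivative[OF assms(2) this, of "replicate n 1"] that(2)
    show ?thesis by (simp add: F_def has_field_derivative_def mult_commute_abs set_replicate_conv_if)
  qed
  have "continuous_on D (F 4)"
    using assms(2)[unfolded Ck_on_def, rule_format, of "replicate 4 1"] by (simp add: F_def)
  then have "bounded (F 4 ` cball \<alpha> r)"
    using r(2) by (intro compact_imp_bounded compact_continuous_image) (auto intro: continuous_on_subset)
  then obtain B where B: "\<And>x. x \<in> cball \<alpha> r \<Longrightarrow> \<bar>F 4 x\<bar> \<le> B"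
    unfolding bounded_iff by (metis imageI real_norm_def)
  have F0: "F 0 = f" by (simp add: F_def)
  have "deriv f \<alpha> = F 1 \<alpha>"
    using dF[of \<alpha> 0] r(1) by (simp add: F0 DERIV_imp_deriv)
  define d2 where "d2 = F 2 \<alpha> / 2"
  define d3 where "d3 = F 3 \<alpha> / 6"
  \<comment> \<open>\<open>R\<close> is the third-order Taylor remainder of \<open>f\<close>, and
    \<open>R1\<close>, \<open>R2\<close>, \<open>R3\<close> are its successive derivatives. The
    bound on the fourth derivative of \<open>f\<close> is integrated down this chain.\<close>
  define R3 where "R3 = (\<lambda>x. F 3 x - 6 * d3)"
  define R2 where "R2 = (\<lambda>x. F 2 x - (2 * d2 + 6 * d3 * (x - \<alpha>)))"
  define R1 where "R1 = (\<lambda>x. F 1 x - (F 1 \<alpha> + 2 * d2 * (x - \<alpha>) + 3 * d3 * (x - \<alpha>)^2))"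
  define R where "R = (\<lambda>x. F 0 x - (F 1 \<alpha> * (x - \<alpha>) + d2 * (x - \<alpha>)^2 + d3 * (x - \<alpha>)^3))"
  have b3: "\<bar>R3 x\<bar> \<le> B * \<bar>x - \<alpha>\<bar> ^ 1" if "\<bar>x - \<alpha>\<bar> \<le> r" for x
  proof -
    have "(R3 has_real_derivative F 4 z) (at z)" if "\<bar>z - \<alpha>\<bar> \<le> r" for z
      unfolding R3_def using dF[OF that, of 3] by (auto intro!: derivative_eq_intros)
    with that deriv_power_bound[of \<alpha> r R3 "F 4" B 0 x] B show ?thesis
      by (simp add: R3_def d3_def dist_real_def abs_minus_commute)
  qed
  have b2: "\<bar>R2 x\<bar> \<le> B * \<bar>x - \<alpha>\<bar> ^ 2" if "\<bar>x - \<alpha>\<bar> \<le> r" for x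
  proof -
    have "(R2 has_real_derivative R3 z) (at z)" if "\<bar>z - \<alpha>\<bar> \<le> r" for z
      unfolding R2_def R3_def using dF[OF that, of 2]
      by (auto simp: numeral_3_eq_3 numeral_2_eq_2 intro!: derivative_eq_intros)
    with that deriv_power_bound[of \<alpha> r R2 R3 B 1 x] b3 show ?thesis
      by (simp add: R2_def d2_def numeral_2_eq_2)
  qed
  have dR1: "(R1 has_real_derivative R2 x) (at x)" if "\<bar>x - \<alpha>\<bar> \<le> r" for x
    unfolding R1_def R2_def using dF[OF that, of 1]
    by (auto simp: numeral_2_eq_2 intro!: derivative_eq_intros)
  have b1: "\<bar>R1 x\<bar> \<le> B * \<bar>x - \<alpha>\<bar> ^ 3" if "\<bar>x - \<alpha>\<bar> \<le> r" for x
    using that deriv_power_bound[of \<alpha> r R1 R2 B 2 x] b2 dR1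
    by (simp add: R1_def numeral_3_eq_3)
  have dR: "(R has_real_derivative R1 x) (at x)" if "\<bar>x - \<alpha>\<bar> \<le> r" for x
    unfolding R_def R1_def using dF[OF that, of 0]
    by (auto intro!: derivative_eq_intros)
  have b0: "\<bar>R x\<bar> \<le> B * \<bar>x - \<alpha>\<bar> ^ 4" if "\<bar>x - \<alpha>\<bar> \<le> r" for x
    using that deriv_power_bound[of \<alpha> r R R1 B 3 x] b1 dR assms(4)
    by (simp add: R_def F0)
  \<comment> \<open>Division by zero makes \<open>q\<close> and \<open>q'\<close> vanish at
    \<alpha>. These are the correct values there, since \<open>R\<close> is O((x -
    \<alpha>)^4).\<close>
  define q where "q = (\<lambda>x. R x / (x - \<alpha>))"
  define q' where "q' = (\<lambda>x. (R1 x * (x - \<alpha>) - R x) / (x - \<alpha>)^2)"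
  have B0: "B \<ge> 0" using B[of \<alpha>] r(1) by fastforce
  have dq: "(q has_real_derivative q' x) (at x)" if x: "\<bar>x - \<alpha>\<bar> \<le> r" for x
  proof (cases "x = \<alpha>")
    case False
    then show ?thesis unfolding q_def q'_def
      by (auto intro!: derivative_eq_intros dR[OF x] simp: power2_eq_square)
  next
    case True
    have "\<forall>\<^sub>F x in at \<alpha>. \<bar>x - \<alpha>\<bar> < r"
      using r(1) by (auto simp: eventually_at dist_real_def)
    moreover have "\<forall>\<^sub>F x in at \<alpha>. x \<noteq> \<alpha>" by (simp add: eventually_at_filter)
    ultimately have "\<forall>\<^sub>F x in at \<alpha>. norm (R x / (x - \<alpha>) / (x - \<alpha>)) \<le> B * \<bar>x - \<alpha>\<bar> ^ 2"
    proof eventually_elim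
      case (elim x)
      then have "\<bar>R x\<bar> / \<bar>x - \<alpha>\<bar> ^ 2 \<le> B * \<bar>x - \<alpha>\<bar> ^ 2"
        using b0[of x] by (simp add: divide_le_eq power2_eq_square power4_eq_xxxx mult.assoc)
      then show ?case by (simp add: abs_mult power2_eq_square)
    qed
    moreover have "((\<lambda>x. B * \<bar>x - \<alpha>\<bar> ^ 2) \<longlongrightarrow> 0) (at \<alpha>)"
      by (auto intro!: tendsto_eq_intros)
    ultimately have "((\<lambda>x. R x / (x - \<alpha>) / (x - \<alpha>)) \<longlongrightarrow> 0) (at \<alpha>)"
      by (rule Lim_null_comparison)
    then show ?thesis using True by (simp add: has_field_derivative_iff q_def q'_def)
  qed
  have bq: "\<bar>q' x\<bar> \<le> 2 * B * \<bar>x - \<alpha>\<bar>^2" if "\<bar>x - \<alpha>\<bar> \<le> r" for x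
  proof (cases "x = \<alpha>")
    case False
    have "\<bar>R1 x * (x - \<alpha>) - R x\<bar> \<le> \<bar>R1 x\<bar> * \<bar>x - \<alpha>\<bar> + \<bar>R x\<bar>"
      by (metis abs_mult abs_triangle_ineq4)
    also have "\<dots> \<le> B * \<bar>x - \<alpha>\<bar> ^ 3 * \<bar>x - \<alpha>\<bar> + B * \<bar>x - \<alpha>\<bar> ^ 4"
      using b0[OF that] b1[OF that] by (intro add_mono mult_right_mono) auto
    also have "\<dots> = 2 * B * \<bar>x - \<alpha>\<bar>^2 * (x - \<alpha>)^2"
      by (simp add: power2_eq_square power3_eq_cube power4_eq_xxxx)
    finally show ?thesis using False by (simp add: q'_def divide_le_eq)
  qed (simp add: q'_def B0)
  show ?thesis
  proof (rule that[of r d2 d3 q "2 * B"])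
    fix x assume "\<bar>x - \<alpha>\<bar> \<le> r"
    have "(x - \<alpha>) * q x = f x - (deriv f \<alpha> * (x - \<alpha>) + d2 * (x - \<alpha>)^2 + d3 * (x - \<alpha>)^3)"
      using assms(4) \<open>deriv f \<alpha> = F 1 \<alpha>\<close> by (cases "x = \<alpha>") (auto simp: q_def R_def F0)
    then show "f x = (x - \<alpha>) * (deriv f \<alpha> + d2 * (x - \<alpha>) + d3 * (x - \<alpha>)^2 + q x)"
      by algebra
  next
    fix u v assume uv: "\<bar>u - \<alpha>\<bar> \<le> r" "\<bar>v - \<alpha>\<bar> \<le> r"
    \<comment> \<open>The smallest ball around \<alpha> that contains both points; on it |z -
      \<alpha>| is at most |u - \<alpha>| + |v - \<alpha>|.\<close>
    define m where "m = max \<bar>u - \<alpha>\<bar> \<bar>v - \<alpha>\<bar>"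
    have "norm (q u - q v) \<le> 2 * B * (\<bar>u - \<alpha>\<bar> + \<bar>v - \<alpha>\<bar>)^2 * norm (u - v)"
    proof (rule field_differentiable_bound[where S = "cball \<alpha> m" and f' = q'])
      fix z assume "z \<in> cball \<alpha> m"
      then have z: "\<bar>z - \<alpha>\<bar> \<le> m" by (simp add: dist_real_def abs_minus_commute)
      then have zr: "\<bar>z - \<alpha>\<bar> \<le> r" using uv by (auto simp: m_def)
      show "(q has_real_derivative q' z) (at z within cball \<alpha> m)"
        by (rule DERIV_subset[OF dq[OF zr]]) simp
      have "\<bar>z - \<alpha>\<bar>^2 \<le> (\<bar>u - \<alpha>\<bar> + \<bar>v - \<alpha>\<bar>)^2"
        using z by (intro power_mono) (auto simp: m_def)
      then show "norm (q' z) \<le> 2 * B * (\<bar>u - \<alpha>\<bar> + \<bar>v - \<alpha>\<bar>)^2"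
        using order.trans[OF bq[OF zr] mult_left_mono] B0 by simp
    qed (auto simp: m_def dist_real_def abs_minus_commute)
    then show "\<bar>q u - q v\<bar> \<le> 2 * B * (\<bar>u - \<alpha>\<bar> + \<bar>v - \<alpha>\<bar>)^2 * \<bar>u - v\<bar>" by simp
  qed (auto simp: r(1) q_def)
qed

text \<open>Here \<open>l\<close> is f[x,\<alpha>], completed by the derivative at \<alpha>, and
  \<open>d\<close> is the linear coefficient of \<open>l\<close>. The divided difference of
  \<open>q\<close> is only O((x - \<alpha>)^2); the factor \<open>s\<close>, which vanishes at
  \<alpha>, supplies the missing power for a cubic error.\<close>

lemma simple_root_divdiff_expansions:
  fixes f :: "real \<Rightarrow> real"
  assumes "open D" "Ck_on 4 f D" "\<alpha> \<in> D" "f \<alpha> = 0"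
  obtains r d l where "r > 0"
    "\<And>x. \<bar>x - \<alpha>\<bar> < r \<Longrightarrow> f x = (x - \<alpha>) * l x"
    "\<And>A a u. expands \<alpha> A 0 a (\<lambda>x. u x - \<alpha>) \<Longrightarrow> expands \<alpha> A (deriv f \<alpha>) (d * a) (\<lambda>x. l (u x))"
    "\<And>A a b c s u v. expands \<alpha> A 0 a (\<lambda>x. u x - \<alpha>) \<Longrightarrow> expands \<alpha> A 0 b (\<lambda>x. v x - \<alpha>) \<Longrightarrow>
      expands \<alpha> A 0 c s \<Longrightarrow> \<forall>\<^sub>F x in at \<alpha> within A. u x \<noteq> v x \<Longrightarrow>
      expands \<alpha> A 0 (c * d) (\<lambda>x. s x * divdiff l (u x) (v x))"
proof -
  obtain r C d2 d3 q where r: "r > 0"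
    and f: "\<And>x. \<bar>x - \<alpha>\<bar> \<le> r \<Longrightarrow>
      f x = (x - \<alpha>) * (deriv f \<alpha> + d2 * (x - \<alpha>) + d3 * (x - \<alpha>)^2 + q x)"
    and q0: "q \<alpha> = 0"
    and q: "\<And>u v. \<bar>u - \<alpha>\<bar> \<le> r \<Longrightarrow> \<bar>v - \<alpha>\<bar> \<le> r \<Longrightarrow>
      \<bar>q u - q v\<bar> \<le> C * (\<bar>u - \<alpha>\<bar> + \<bar>v - \<alpha>\<bar>)^2 * \<bar>u - v\<bar>"
    by (rule simple_root_factor[OF assms], rule that; assumption)
  define l where "l = (\<lambda>x. deriv f \<alpha> + d2 * (x - \<alpha>) + d3 * (x - \<alpha>)^2 + q x)"
  have near: "\<forall>\<^sub>F x in at \<alpha> within A. \<bar>u x - \<alpha>\<bar> \<le> r"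
    if "expands \<alpha> A 0 a (\<lambda>x. u x - \<alpha>)" for A a u
    using order_tendstoD(2)[OF tendsto_rabs_zero[OF expands_tendsto[OF that]] r]
    by eventually_elim simp
  show ?thesis
  proof (rule that[OF r])
    show "f x = (x - \<alpha>) * l x" if "\<bar>x - \<alpha>\<bar> < r" for x
      using f[of x] that by (simp add: l_def)
  next
    fix A a u assume u: "expands \<alpha> A 0 a (\<lambda>x. u x - \<alpha>)"
    have "\<forall>\<^sub>F x in at \<alpha> within A. norm (q (u x)) \<le> C * norm ((u x - \<alpha>)^3)"
      using near[OF u]
    proof eventually_elim
      case (elim x)
      then show ?case using q[of "u x" \<alpha>] r by (simp add: q0 power_abs power2_eq_square power3_eq_cube abs_mult)
    qed
    then have "(\<lambda>x. q (u x)) \<in> O[at \<alpha> within A](\<lambda>x. (u x - \<alpha>)^3)" by (rule bigoI)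
    also have "(\<lambda>x. (u x - \<alpha>)^3) \<in> O[at \<alpha> within A](\<lambda>x. (x - \<alpha>)^3)"
      by (rule landau_o.big_power[OF expands_0_bigo[OF u]])
    finally have qu: "expands \<alpha> A 0 0 (\<lambda>x. q (u x))" by (rule expands_bigo)
    show "expands \<alpha> A (deriv f \<alpha>) (d2 * a) (\<lambda>x. l (u x))"
      by (rule expands_cong[OF expands_add[OF expands_add[OF expands_add[OF
            expands_const[of \<alpha> A "deriv f \<alpha>"] expands_cmult[OF u, of d2]]
            expands_cmult[OF expands_mult[OF u u], of d3]] qu]])
         (auto simp: l_def power2_eq_square)
  next
    fix A a b c s u v
    assume u: "expands \<alpha> A 0 a (\<lambda>x. u x - \<alpha>)" and v: "expands \<alpha> A 0 b (\<lambda>x. v x - \<alpha>)"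
      and s: "expands \<alpha> A 0 c s" and ne: "\<forall>\<^sub>F x in at \<alpha> within A. u x \<noteq> v x"
    let ?m = "\<lambda>x. \<bar>u x - \<alpha>\<bar> + \<bar>v x - \<alpha>\<bar>"
    have "\<forall>\<^sub>F x in at \<alpha> within A. norm (divdiff q (u x) (v x)) \<le> C * norm (?m x ^ 2)"
      using near[OF u] near[OF v] ne
    proof eventually_elim
      case (elim x)
      then show ?case using q[of "u x" "v x"] by (simp add: divdiff_def divide_le_eq)
    qed
    then have "(\<lambda>x. divdiff q (u x) (v x)) \<in> O[at \<alpha> within A](\<lambda>x. ?m x ^ 2)" by (rule bigoI)
    also have "?m \<in> O[at \<alpha> within A](\<lambda>x. x - \<alpha>)"
      using expands_0_bigo[OF u] expands_0_bigo[OF v] by (intro sum_in_bigo(1)) simp_all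
    then have "(\<lambda>x. ?m x ^ 2) \<in> O[at \<alpha> within A](\<lambda>x. (x - \<alpha>)^2)"
      by (rule landau_o.big_power)
    finally have "(\<lambda>x. s x * divdiff q (u x) (v x)) \<in> O[at \<alpha> within A](\<lambda>x. (x - \<alpha>) * (x - \<alpha>)^2)"
      by (rule landau_o.big.mult[OF expands_0_bigo[OF s]])
    then have qq: "expands \<alpha> A 0 0 (\<lambda>x. s x * divdiff q (u x) (v x))"
      by (intro expands_bigo) (simp add: power3_eq_cube power2_eq_square mult.assoc)
    have lin: "expands \<alpha> A d2 (d3 * (a + b)) (\<lambda>x. d2 + d3 * ((u x - \<alpha>) + (v x - \<alpha>)))"
      using expands_add[OF expands_const[of \<alpha> A d2] expands_cmult[OF expands_add[OF u v], of d3]] by simp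
    have "\<forall>\<^sub>F x in at \<alpha> within A. s x * (d2 + d3 * ((u x - \<alpha>) + (v x - \<alpha>))) + s x * divdiff q (u x) (v x)
        = s x * divdiff l (u x) (v x)"
      using ne
    proof eventually_elim
      case (elim x)
      have "divdiff l (u x) (v x) = d2 + d3 * ((u x - \<alpha>) + (v x - \<alpha>)) + divdiff q (u x) (v x)"
        using elim unfolding divdiff_def l_def
        by (simp add: field_simps power2_eq_square)
      then show ?case by (simp add: distrib_left)
    qed
    from expands_cong[OF expands_add[OF expands_mult[OF s lin] qq] this]
    show "expands \<alpha> A 0 (c * d2) (\<lambda>x. s x * divdiff l (u x) (v x))" by simp
  qed
qed

text \<open>The product rule for divided differences, applied to (x - \<alpha>) l(x).\<close>

lemma divdiff_factor:
  assumes "f u = (u - \<alpha>) * l u" "f v = (v - \<alpha>) * l v" "u \<noteq> v"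
  shows "divdiff f u v = l u + (v - \<alpha>) * divdiff l u v"
  using assms by (simp add: divdiff_def field_simps)

section \<open>The order of the scheme\<close>

theorem theorem4:
  fixes D :: "real set" and f :: "real \<Rightarrow> real" and \<alpha> :: real
    and \<kappa> g1 g2 h1 h2 h3 h4 h5 :: real
    and G0 G1 :: "real \<Rightarrow> real"
    and G2 :: "real \<times> real \<Rightarrow> real"
    and S0 :: "real \<times> real \<times> real \<Rightarrow> real"
    and S1 S2 S3 S4 :: "real \<times> real \<times> real \<times> real \<Rightarrow> real"
    and S5 :: "real \<times> real \<times> real \<times> real \<times> real \<Rightarrow> real"
    and w y z t1 t2 t3 t4 t5 \<Phi> :: "real \<Rightarrow> real"
    and A :: "real set"
  assumes "open D" and "is_interval D" and "Ck_on 4 f D"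
    and "\<alpha> \<in> D" and "f \<alpha> = 0" and "deriv f \<alpha> \<noteq> 0"
    and "\<kappa> \<noteq> 0"
    and w: "w = (\<lambda>x. x - \<kappa> * f x)"
    and y: "y = (\<lambda>x. x - f x / divdiff f x (w x))"
    and t1: "t1 = (\<lambda>x. f (y x) / f x)"
    and t2: "t2 = (\<lambda>x. f (y x) / f (w x))"
    and z: "z = (\<lambda>x. y x -
          ((1 - g1 - g2) / divdiff f (y x) (w x) * G0 (t1 x)
           + g1 / divdiff f (y x) x * G1 (t2 x)
           + g2 / divdiff f x (w x) * G2 (t1 x, t2 x)) * f (y x))"
    and t3: "t3 = (\<lambda>x. f (z x) / f x)"
    and t4: "t4 = (\<lambda>x. f (z x) / f (w x))"
    and t5: "t5 = (\<lambda>x. f (z x) / f (y x))"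
    and \<Phi>: "\<Phi> = (\<lambda>x. z x -
          ((1 - h1 - h2 - h3 - h4 - h5) / divdiff f (y x) (z x) * S0 (t3 x, t4 x, t5 x)
           + h1 / divdiff f (z x) (w x) * S1 (t1 x, t3 x, t4 x, t5 x)
           + h2 / divdiff f (z x) x * S2 (t2 x, t3 x, t4 x, t5 x)
           + h3 / divdiff f x (y x) * S3 (t2 x, t3 x, t4 x, t5 x)
           + h4 / divdiff f (y x) (w x) * S4 (t1 x, t3 x, t4 x, t5 x)
           + h5 / divdiff f x (w x) * S5 (t1 x, t2 x, t3 x, t4 x, t5 x)) * f (z x))"
    and A: "A = {x.
          f x \<noteq> 0 \<and> f (w x) \<noteq> 0 \<and> f (y x) \<noteq> 0 \<and>
          x \<noteq> w x \<and> divdiff f x (w x) \<noteq> 0 \<and>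
          y x \<noteq> w x \<and> divdiff f (y x) (w x) \<noteq> 0 \<and>
          y x \<noteq> x \<and> divdiff f (y x) x \<noteq> 0 \<and>
          y x \<noteq> z x \<and> divdiff f (y x) (z x) \<noteq> 0 \<and>
          z x \<noteq> w x \<and> divdiff f (z x) (w x) \<noteq> 0 \<and>
          z x \<noteq> x \<and> divdiff f (z x) x \<noteq> 0}"
    and "weight_fun G0" and "weight_fun G1" and "weight_fun G2"
    and "weight_fun S0" and "weight_fun S1" and "weight_fun S2"
    and "weight_fun S3" and "weight_fun S4" and "weight_fun S5"
    and "G0 0 = 1" and "G1 0 = 1" and "G2 (0, 0) = 1"
    and "(G0 has_real_derivative 1) (at 0)"
    and "(G1 has_real_derivative 1) (at 0)"
    and "((\<lambda>t. G2 (t, 0)) has_real_derivative 1) (at 0)"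
    and "((\<lambda>t. G2 (0, t)) has_real_derivative 1) (at 0)"
    and "S0 (0, 0, 0) = 1"
    and "S1 (0, 0, 0, 0) = 1" and "S2 (0, 0, 0, 0) = 1"
    and "S3 (0, 0, 0, 0) = 1" and "S4 (0, 0, 0, 0) = 1"
    and "S5 (0, 0, 0, 0, 0) = 1"
    and "((\<lambda>t. S1 (t, 0, 0, 0)) has_real_derivative 1) (at 0)"
    and "((\<lambda>t. S2 (t, 0, 0, 0)) has_real_derivative 1) (at 0)"
    and "((\<lambda>t. S3 (t, 0, 0, 0)) has_real_derivative 1) (at 0)"
    and "((\<lambda>t. S4 (t, 0, 0, 0)) has_real_derivative 1) (at 0)"
    and "((\<lambda>t. S5 (t, 0, 0, 0, 0)) has_real_derivative 1) (at 0)"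
    and "((\<lambda>t. S5 (0, t, 0, 0, 0)) has_real_derivative 1) (at 0)"
  shows "locally_convergent \<Phi> A \<alpha> \<and> convergence_order_ge 6 \<Phi> A \<alpha>"
proof -

  \<comment> \<open>Constants at the root and expansions of divided differences\<close>
  have nz: "deriv f \<alpha> \<noteq> 0" by fact
  define f1 where "f1 = deriv f \<alpha>"
  have f1: "f1 \<noteq> 0" using nz by (simp add: f1_def)
  obtain r d l where r: "r > 0"
    and fl: "\<And>x. \<bar>x - \<alpha>\<bar> < r \<Longrightarrow> f x = (x - \<alpha>) * l x"
    and el: "\<And>A a u. expands \<alpha> A 0 a (\<lambda>x. u x - \<alpha>) \<Longrightarrow> expands \<alpha> A f1 (d * a) (\<lambda>x. l (u x))"
    and edl: "\<And>A a b c s u v. expands \<alpha> A 0 a (\<lambda>x. u x - \<alpha>) \<Longrightarrow> expands \<alpha> A 0 b (\<lambda>x. v x - \<alpha>) \<Longrightarrow>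
      expands \<alpha> A 0 c s \<Longrightarrow> \<forall>\<^sub>F x in at \<alpha> within A. u x \<noteq> v x \<Longrightarrow>
      expands \<alpha> A 0 (c * d) (\<lambda>x. s x * divdiff l (u x) (v x))"
    by (rule simple_root_divdiff_expansions[OF \<open>open D\<close> \<open>Ck_on 4 f D\<close> \<open>\<alpha> \<in> D\<close> \<open>f \<alpha> = 0\<close>, folded f1_def],
        rule that; assumption)
  define c where "c = d / f1"
  have d: "d = c * f1" using f1 by (simp add: c_def)
  have mem: "\<forall>\<^sub>F x in at \<alpha> within A. x \<in> A" by (simp add: eventually_at_filter)
  have inA: "\<forall>\<^sub>F x in at \<alpha> within A. P x" if "\<And>x. x \<in> A \<Longrightarrow> P x" for P
    using mem by (rule eventually_mono) (rule that)
  have near: "\<forall>\<^sub>F x in at \<alpha> within A. \<bar>u x - \<alpha>\<bar> < r" if "expands \<alpha> A 0 a (\<lambda>x. u x - \<alpha>)" for a u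
    using order_tendstoD(2)[OF tendsto_rabs_zero[OF expands_tendsto[OF that]] r] .
  \<comment> \<open>In the product rule f[u,v] = l(u) + (v - \<alpha>) l[u,v] the first term
    contributes \<open>a\<close> and the second \<open>b\<close> to the linear coefficient.\<close>
  have edd: "expands \<alpha> A f1 (f1 * (c * (a + b))) (\<lambda>x. divdiff f (u x) (v x))"
    if u: "expands \<alpha> A 0 a (\<lambda>x. u x - \<alpha>)" and v: "expands \<alpha> A 0 b (\<lambda>x. v x - \<alpha>)"
      and ne: "\<And>x. x \<in> A \<Longrightarrow> u x \<noteq> v x" for a b u v
  proof (rule expands_cong[OF expands_add[OF el[OF u] edl[OF u v v inA[OF ne]]]])
    show "\<forall>\<^sub>F x in at \<alpha> within A. l (u x) + (v x - \<alpha>) * divdiff l (u x) (v x) = divdiff f (u x) (v x)"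
      using near[OF u] near[OF v] mem
      by eventually_elim (use fl ne divdiff_factor in metis)
  qed (auto simp: d algebra_simps)

  \<comment> \<open>Errors of the first two substeps\<close>
  define om where "om = 1 - \<kappa> * f1"
  have alpha: "\<alpha> \<notin> A" using \<open>f \<alpha> = 0\<close> by (simp add: A)
  have ex: "expands \<alpha> A 0 1 (\<lambda>x. x - \<alpha>)" by (rule expands_err)
  have elx: "expands \<alpha> A f1 (f1 * c) l" using el[OF ex] by (simp add: d mult_ac)
  have fx: "\<forall>\<^sub>F x in at \<alpha> within A. f x = (x - \<alpha>) * l x"
    using near[OF ex] by eventually_elim (rule fl)
  \<comment> \<open>Near the root \<omega> is the ratio of the error of \<open>w\<close> to that of
    \<open>x\<close>; its limit \<open>om\<close> may be zero.\<close>
  define \<omega> where "\<omega> = (\<lambda>x. 1 - \<kappa> * l x)"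
  have e\<omega>: "expands \<alpha> A om (- \<kappa> * f1 * c) \<omega>"
    using expands_diff[OF expands_const[of \<alpha> A 1] expands_cmult[OF elx, of \<kappa>]]
    by (simp add: \<omega>_def om_def mult_ac)
  have w_err: "\<forall>\<^sub>F x in at \<alpha> within A. w x - \<alpha> = (x - \<alpha>) * \<omega> x"
    using fx by eventually_elim (simp add: w \<omega>_def right_diff_distrib mult_ac)
  have ew: "expands \<alpha> A 0 om (\<lambda>x. w x - \<alpha>)"
    using w_err by (intro expands_cong[OF expands_mult[OF ex e\<omega>]]) (auto elim: eventually_mono)
  have ne: "x \<noteq> w x" "y x \<noteq> x" "y x \<noteq> w x" "z x \<noteq> y x" "z x \<noteq> w x" "z x \<noteq> x"
    "f x \<noteq> 0" "f (w x) \<noteq> 0" "f (y x) \<noteq> 0"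
    "divdiff f x (w x) \<noteq> 0" "divdiff f (y x) (w x) \<noteq> 0" "divdiff f (y x) x \<noteq> 0"
    "divdiff f (y x) (z x) \<noteq> 0" "divdiff f (z x) (w x) \<noteq> 0" "divdiff f (z x) x \<noteq> 0" if "x \<in> A" for x
    using that by (auto simp: A)
  have efxw: "expands \<alpha> A f1 (f1 * (c * (1 + om))) (\<lambda>x. divdiff f x (w x))"
    using edd[OF ex ew] ne(1) by metis
  (* Keeping w x - \<alpha> as a separate factor of y x - \<alpha> lets it cancel against f (w x) in t2 and t4,
     whose limits would otherwise be out of reach when om = 0. *)
  define \<mu> where "\<mu> = (\<lambda>x. (x - \<alpha>) * divdiff l x (w x) / divdiff f x (w x))"
  have e\<mu>: "expands \<alpha> A 0 c \<mu>"
    unfolding \<mu>_def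
    by (rule expands_cong[OF expands_divide[OF edl[OF ex ew ex inA] efxw f1]])
      (use ne(1) f1 in \<open>auto simp: d\<close>)
  \<comment> \<open>Since f(x) = (x - \<alpha>) l(x), the error of \<open>y\<close> is (x -
    \<alpha>) (f[x,w] - l(x)) / f[x,w], and the product rule turns the difference into (w -
    \<alpha>) l[x,w].\<close>
  have y_err: "\<forall>\<^sub>F x in at \<alpha> within A. y x - \<alpha> = (w x - \<alpha>) * \<mu> x"
    using fx near[OF ex] near[OF ew] mem
  proof eventually_elim
    case (elim x)
    have "divdiff f x (w x) = l x + (w x - \<alpha>) * divdiff l x (w x)"
      using elim fl ne(1) by (metis divdiff_factor)
    then have "(w x - \<alpha>) * divdiff l x (w x) = divdiff f x (w x) - l x" by simp
    then have "(w x - \<alpha>) * \<mu> x = (x - \<alpha>) * (divdiff f x (w x) - l x) / divdiff f x (w x)"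
      by (simp add: \<mu>_def mult_ac)
    then show ?case using elim ne(10)[OF elim(4)] by (simp add: y field_simps)
  qed
  have ey: "expands \<alpha> A 0 0 (\<lambda>x. y x - \<alpha>)"
    using y_err by (intro expands_cong[OF expands_mult[OF ew e\<mu>]]) (auto elim: eventually_mono)
  have elw: "expands \<alpha> A f1 (f1 * (c * om)) (\<lambda>x. l (w x))"
    using el[OF ew] by (simp add: d mult_ac)
  have ely: "expands \<alpha> A f1 0 (\<lambda>x. l (y x))" using el[OF ey] by simp
  have err_ne: "x - \<alpha> \<noteq> 0" "w x - \<alpha> \<noteq> 0" "y x - \<alpha> \<noteq> 0" if "x \<in> A" for x
    using ne(7-9)[OF that] \<open>f \<alpha> = 0\<close> by auto

  \<comment> \<open>The ratios formed with f(y)\<close>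
  have fw: "\<forall>\<^sub>F x in at \<alpha> within A. f (w x) = (w x - \<alpha>) * l (w x)"
    using near[OF ew] by eventually_elim (rule fl)
  have fy: "\<forall>\<^sub>F x in at \<alpha> within A. f (y x) = (y x - \<alpha>) * l (y x)"
    using near[OF ey] by eventually_elim (rule fl)
  \<comment> \<open>The common factor x - \<alpha> of numerator and denominator cancels, leaving
    factors with known expansions.\<close>
  have et1: "expands \<alpha> A 0 (c * om) t1"
  proof (rule expands_cong[OF expands_mult[OF e\<omega> expands_mult[OF e\<mu> expands_divide[OF ely elx f1]]]])
    show "\<forall>\<^sub>F x in at \<alpha> within A. \<omega> x * (\<mu> x * (l (y x) / l x)) = t1 x"
      using fx fy w_err y_err mem
      by eventually_elim (use err_ne(1) in \<open>simp add: t1\<close>)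
  qed (use f1 in auto)
  have et2: "expands \<alpha> A 0 c t2"
  proof (rule expands_cong[OF expands_mult[OF e\<mu> expands_divide[OF ely elw f1]]])
    show "\<forall>\<^sub>F x in at \<alpha> within A. \<mu> x * (l (y x) / l (w x)) = t2 x"
      using fw fy y_err mem
      by eventually_elim (use err_ne(2) in \<open>simp add: t2\<close>)
  qed (use f1 in auto)
  (* The linear terms of V and W cancel. *)
  have step: "expands \<alpha> A g 0 (\<lambda>x. L x * (g / V x * W x))"
    if L: "expands \<alpha> A f1 0 L" and V: "expands \<alpha> A f1 (f1 * (c * a)) V"
      and W: "expands \<alpha> A 1 (c * a) W" for g a L V W
    by (rule expands_cong[OF expands_mult[OF L expands_mult[OF expands_divide[OF expands_const[of \<alpha> A g] V f1] W]]])
      (use f1 in auto)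
  \<comment> \<open>\<open>step\<close> in the shape in which it is used: \<open>edd\<close> yields
    a sum of two error coefficients, such as 0 + om, and the coefficient of the weight is matched
    against it.\<close>
  have step': "expands \<alpha> A g 0 (\<lambda>x. L x * (g / V x * W x))"
    if "expands \<alpha> A f1 0 L" "expands \<alpha> A f1 (f1 * (c * (a + b))) V"
      and "expands \<alpha> A 1 b' W" "b' = c * (a + b)" for g a b b' L V W
    using step[of L "a + b" V W g] that by simp

  \<comment> \<open>The first bracket and the error of \<open>z\<close>\<close>
  have eyw: "expands \<alpha> A f1 (f1 * (c * (0 + om))) (\<lambda>x. divdiff f (y x) (w x))"
    by (rule edd[OF ey ew ne(3)])
  have eyx: "expands \<alpha> A f1 (f1 * (c * (0 + 1))) (\<lambda>x. divdiff f (y x) x)"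
    by (rule edd[OF ey ex ne(2)])
  have exy: "expands \<alpha> A f1 (f1 * (c * (1 + 0))) (\<lambda>x. divdiff f x (y x))"
    using edd[OF ex ey] ne(2) by metis
  have eG0: "expands \<alpha> A 1 (c * om) (\<lambda>x. G0 (t1 x))"
    using expands_weight_ray[OF \<open>weight_fun G0\<close>, of 1 1 \<alpha> A "c * om" t1] assms et1
    by (simp add: expands_vec_real)
  have eG1: "expands \<alpha> A 1 c (\<lambda>x. G1 (t2 x))"
    using expands_weight_ray[OF \<open>weight_fun G1\<close>, of 1 1 \<alpha> A c t2] assms et2
    by (simp add: expands_vec_real)
  have eG2: "expands \<alpha> A 1 (c * om + c) (\<lambda>x. G2 (t1 x, t2 x))"
    using expands_weight_ray2[OF \<open>weight_fun G2\<close>, of "(1, 0)" 1 "(0, 1)" 1 \<alpha> A "c * om" c "\<lambda>x. (t1 x, t2 x)"]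
      expands_vec_Pair[OF et1 et2[folded expands_vec_real]] assms
    by (simp add: zero_prod_def)
  \<comment> \<open>\<open>l (y x)\<close> is distributed over the bracket so that each summand fits
    \<open>step'\<close>. The parameters add up to 1, which cancels the leading 1.\<close>
  define N where "N = (\<lambda>x. 1 - (l (y x) * ((1 - g1 - g2) / divdiff f (y x) (w x) * G0 (t1 x))
    + l (y x) * (g1 / divdiff f (y x) x * G1 (t2 x))
    + l (y x) * (g2 / divdiff f x (w x) * G2 (t1 x, t2 x))))"
  have eN: "expands \<alpha> A 0 0 N"
    unfolding N_def
    by (rule expands_cong[OF expands_diff[OF expands_const[of \<alpha> A 1] expands_add[OF expands_add[OF
        step'[OF ely eyw eG0, where g = "1 - g1 - g2"] step'[OF ely eyx eG1, where g = "g1"]] step'[OF ely efxw eG2, where g = "g2"]]]])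
      (simp_all add: distrib_left)
  have z_err: "\<forall>\<^sub>F x in at \<alpha> within A. z x - \<alpha> = (y x - \<alpha>) * N x"
    using fy
  proof eventually_elim
    case (elim x)
    have factor: "e * (1 - (L * a + L * b + L * c)) = e - (a + b + c) * (e * L)" for e L a b c :: real
      by algebra
    show ?case
      unfolding N_def factor elim[symmetric] z by (simp only: diff_diff_eq add.commute)
  qed
  have ez: "expands \<alpha> A 0 0 (\<lambda>x. z x - \<alpha>)"
    using z_err by (intro expands_cong[OF expands_mult[OF ey eN]]) (auto elim: eventually_mono)

  \<comment> \<open>The ratios formed with f(z)\<close>
  have elz: "expands \<alpha> A f1 0 (\<lambda>x. l (z x))" using el[OF ez] by simp
  have fz: "\<forall>\<^sub>F x in at \<alpha> within A. f (z x) = (z x - \<alpha>) * l (z x)"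
    using near[OF ez] by eventually_elim (rule fl)
  \<comment> \<open>\<open>t3\<close>, \<open>t4\<close> and \<open>t5\<close> all contain the
    factor \<open>N\<close>, so they have no linear term, and only \<open>t1\<close> and
    \<open>t2\<close> influence the linear coefficients of the second set of weights.\<close>
  have et3: "expands \<alpha> A 0 0 t3"
  proof (rule expands_cong[OF expands_mult[OF e\<omega> expands_mult[OF e\<mu> expands_mult[OF eN
          expands_divide[OF elz elx f1]]]]])
    show "\<forall>\<^sub>F x in at \<alpha> within A. \<omega> x * (\<mu> x * (N x * (l (z x) / l x))) = t3 x"
      using fx fz w_err y_err z_err mem
      by eventually_elim (use err_ne(1) in \<open>simp add: t3\<close>)
  qed auto
  have et4: "expands \<alpha> A 0 0 t4"
  proof (rule expands_cong[OF expands_mult[OF e\<mu> expands_mult[OF eN expands_divide[OF elz elw f1]]]])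
    show "\<forall>\<^sub>F x in at \<alpha> within A. \<mu> x * (N x * (l (z x) / l (w x))) = t4 x"
      using fw fz y_err z_err mem
      by eventually_elim (use err_ne(2) in \<open>simp add: t4\<close>)
  qed auto
  have et5: "expands \<alpha> A 0 0 t5"
  proof (rule expands_cong[OF expands_mult[OF eN expands_divide[OF elz ely f1]]])
    show "\<forall>\<^sub>F x in at \<alpha> within A. N x * (l (z x) / l (y x)) = t5 x"
      using fy fz z_err mem
      by eventually_elim (use err_ne(3) in \<open>simp add: t5\<close>)
  qed auto
  note et345 = expands_vec_Pair[OF et3 expands_vec_Pair[OF et4 et5[folded expands_vec_real]]]
  \<comment> \<open>All three arguments have zero linear part, so the zero direction is taken; along
    it the weight is constant and its derivative is 0.\<close>
  have eS0: "expands \<alpha> A 1 0 (\<lambda>x. S0 (t3 x, t4 x, t5 x))"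
    using expands_weight_ray[OF \<open>weight_fun S0\<close>, of 0 0 \<alpha> A 0 "\<lambda>x. (t3 x, t4 x, t5 x)"] et345 assms
    by (simp add: zero_prod_def)
  have weight4: "expands \<alpha> A 1 b (\<lambda>x. W (s x, t3 x, t4 x, t5 x))"
    if "weight_fun W" "W (0, 0, 0, 0) = 1" "((\<lambda>t. W (t, 0, 0, 0)) has_real_derivative 1) (at 0)"
      "expands \<alpha> A 0 b s" for W b s
    using expands_weight_ray[OF that(1), of "(1, 0, 0, 0)" 1 \<alpha> A b "\<lambda>x. (s x, t3 x, t4 x, t5 x)"]
      expands_vec_Pair[OF that(4) et345] that(2,3)
    by (simp add: zero_prod_def)
  have eS1: "expands \<alpha> A 1 (c * om) (\<lambda>x. S1 (t1 x, t3 x, t4 x, t5 x))"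
    and eS4: "expands \<alpha> A 1 (c * om) (\<lambda>x. S4 (t1 x, t3 x, t4 x, t5 x))"
    and eS2: "expands \<alpha> A 1 c (\<lambda>x. S2 (t2 x, t3 x, t4 x, t5 x))"
    and eS3: "expands \<alpha> A 1 c (\<lambda>x. S3 (t2 x, t3 x, t4 x, t5 x))"
    by (intro weight4 et1 et2; fact)+
  have eS5: "expands \<alpha> A 1 (c * om + c) (\<lambda>x. S5 (t1 x, t2 x, t3 x, t4 x, t5 x))"
    using expands_weight_ray2[OF \<open>weight_fun S5\<close>, of "(1, 0, 0, 0, 0)" 1 "(0, 1, 0, 0, 0)" 1 \<alpha> A "c * om" c
        "\<lambda>x. (t1 x, t2 x, t3 x, t4 x, t5 x)"]
      expands_vec_Pair[OF et1 expands_vec_Pair[OF et2 et345]] assms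
    by (simp add: zero_prod_def)

  \<comment> \<open>The second bracket\<close>
  have eyz: "expands \<alpha> A f1 (f1 * (c * (0 + 0))) (\<lambda>x. divdiff f (y x) (z x))"
    using edd[OF ey ez] ne(4) by metis
  have ezw: "expands \<alpha> A f1 (f1 * (c * (0 + om))) (\<lambda>x. divdiff f (z x) (w x))"
    by (rule edd[OF ez ew ne(5)])
  have ezx: "expands \<alpha> A f1 (f1 * (c * (0 + 1))) (\<lambda>x. divdiff f (z x) x)"
    by (rule edd[OF ez ex ne(6)])
  \<comment> \<open>Built like \<open>N\<close>: six summands for \<open>step'\<close>, with
    parameters that again add up to 1.\<close>
  define M where "M = (\<lambda>x. 1 - (l (z x) * ((1 - h1 - h2 - h3 - h4 - h5) / divdiff f (y x) (z x) * S0 (t3 x, t4 x, t5 x))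
    + l (z x) * (h1 / divdiff f (z x) (w x) * S1 (t1 x, t3 x, t4 x, t5 x))
    + l (z x) * (h2 / divdiff f (z x) x * S2 (t2 x, t3 x, t4 x, t5 x))
    + l (z x) * (h3 / divdiff f x (y x) * S3 (t2 x, t3 x, t4 x, t5 x))
    + l (z x) * (h4 / divdiff f (y x) (w x) * S4 (t1 x, t3 x, t4 x, t5 x))
    + l (z x) * (h5 / divdiff f x (w x) * S5 (t1 x, t2 x, t3 x, t4 x, t5 x))))"
  have eM: "expands \<alpha> A 0 0 M"
    unfolding M_def
    by (rule expands_cong[OF expands_diff[OF expands_const[of \<alpha> A 1] expands_add[OF expands_add[OF
          expands_add[OF expands_add[OF expands_add[OF
          step'[OF elz eyz eS0, where g = "1 - h1 - h2 - h3 - h4 - h5"] step'[OF elz ezw eS1, where g = "h1"]] step'[OF elz ezx eS2, where g = "h2"]] step'[OF elz exy eS3, where g = "h3"]]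
          step'[OF elz eyw eS4, where g = "h4"]] step'[OF elz efxw eS5, where g = "h5"]]]])
      (simp_all add: distrib_left)
  \<comment> \<open>The whole error as a product of factors vanishing to orders at least 1, 0, 1, 2
    and 2.\<close>
  have \<Phi>_err: "\<forall>\<^sub>F x in at \<alpha> within A. (x - \<alpha>) * (\<omega> x * (\<mu> x * (N x * M x))) = \<Phi> x - \<alpha>"
    using w_err y_err z_err fz
  proof eventually_elim
    case (elim x)
    have factor: "e * (1 - (L * a0 + L * a1 + L * a2 + L * a3 + L * a4 + L * a5)) =
        e - (a0 + a1 + a2 + a3 + a4 + a5) * (e * L)" for e L a0 a1 a2 a3 a4 a5 :: real
      by algebra
    have "\<Phi> x - \<alpha> = (z x - \<alpha>) * M x"
      unfolding M_def factor elim(4)[symmetric] \<Phi> by (simp only: diff_diff_eq add.commute)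
    also have "\<dots> = (x - \<alpha>) * (\<omega> x * (\<mu> x * (N x * M x)))"
      using elim(1-3) by simp
    finally show ?case by simp
  qed

  \<comment> \<open>The error equation of order six\<close>
  obtain k m where k: "(\<lambda>x. N x - k * (x - \<alpha>)^2) \<in> O[at \<alpha> within A](\<lambda>x. (x - \<alpha>)^(2 + 1))"
    and m: "(\<lambda>x. M x - m * (x - \<alpha>)^2) \<in> O[at \<alpha> within A](\<lambda>x. (x - \<alpha>)^(2 + 1))"
    using expands_leading(3)[OF eN] expands_leading(3)[OF eM] by blast
  \<comment> \<open>The exponent is nested like the product so that
    \<open>leading_terms_mult\<close> applies factor by factor. The error constant is the product of
    the leading coefficients and vanishes, for instance, when \<open>om\<close> is 0.\<close>
  have "(\<lambda>x. (x - \<alpha>) * (\<omega> x * (\<mu> x * (N x * M x))) - 1 * (om * (c * (k * m))) * (x - \<alpha>)^(1 + (0 + (1 + (2 + 2)))))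
      \<in> O[at \<alpha> within A](\<lambda>x. (x - \<alpha>)^(1 + (0 + (1 + (2 + 2))) + 1))"
    by (intro leading_terms_mult expands_leading(1)[OF e\<omega>] expands_leading(2)[OF e\<mu>]
        expands_leading(2)[OF ex] k m)
  moreover have "1 + (0 + (1 + (2 + 2))) = (6::nat)" by simp
  moreover have "\<forall>\<^sub>F x in at \<alpha> within A.
      (x - \<alpha>) * (\<omega> x * (\<mu> x * (N x * M x))) - 1 * (om * (c * (k * m))) * (x - \<alpha>)^6 =
      (\<Phi> x - \<alpha>) - om * (c * (k * m)) * (x - \<alpha>)^6"
    using \<Phi>_err by eventually_elim simp
  ultimately have "(\<lambda>x. (\<Phi> x - \<alpha>) - om * (c * (k * m)) * (x - \<alpha>)^6) \<in>
      O[at \<alpha> within A](\<lambda>x. (x - \<alpha>)^(6 + 1))"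
    by (simp only: landau_o.big.in_cong)
  then have "convergence_order_ge 6 \<Phi> A \<alpha>"
    unfolding convergence_order_ge_def by blast
  then show ?thesis
    using order_ge_2_locally_convergent alpha by simp
qed

end
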